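(* Let $G$ be a finite simple graph and $n\geq 1$. Then $\mathrm{Hom}(G,K_n)$ is $(n-\dot{\chi}(G)-1)$-connected.
   Context: For the complete graph $K_n$ on vertex set $[n]=\{1,\ldots,n\}$, $\mathrm{Hom}(G,K_n)$ is the regular cell complex whose cells are the functions $\eta:V(G)\to 2^{[n]}\setminus\{\emptyset\}$ such that $\eta(x)\cap\eta(y)=\emptyset$ whenever $x,y$ are adjacent in $G$; each cell is the product of simplices $\prod_{v}\Delta^{\eta(v)}$, and $\eta'$ is a face of $\eta$ iff $\eta'(v)\subseteq\eta(v)$ for all $v$. A space is $m$-connected if it is nonempty and $\pi_i$ vanishes for $0\le i\leq m$ ($(-1)$-connected means nonempty; the condition is vacuous for $m<-1$). A covering $I_1,\ldots,I_k$ of $G$ is a sequence of independent subsets of $V(G)$ partitioning $V(G)$ such that for each $i$, $I_i$ is a maximal independent set in the induced subgraph of $G$ on $I_i\cup I_{i+1}\cup\cdots\cup I_k$; $\dot{\chi}(G)$ is the maximal number of sets in a covering of $G$. *)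

theory Defs
  imports "HOL-Analysis.Analysis" "Graph_Theory.Digraph_Component"
begin

text \<open>
  Finite simple graphs are the \<^locale>\<open>graph\<close>s of \<^theory>\<open>Graph_Theory.Digraph\<close>: finite
  symmetric digraphs without loops and parallel arcs (an undirected edge is a pair of opposite
  arcs). The null graph is allowed.
\<close>

definition independent_set :: "('a, 'b) pre_digraph \<Rightarrow> 'a set \<Rightarrow> bool" where
  "independent_set G S \<longleftrightarrow> S \<subseteq> verts G \<and> (\<forall>u\<in>S. \<forall>v\<in>S. \<not> u \<rightarrow>\<^bsub>G\<^esub> v)"

definition maximal_independent :: "('a, 'b) pre_digraph \<Rightarrow> 'a set \<Rightarrow> bool" where
  "maximal_independent G S \<longleftrightarrow>
     independent_set G S \<and> (\<forall>T. independent_set G T \<and> S \<subseteq> T \<longrightarrow> T = S)"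

text \<open>
  The parts of a covering are nonempty, by \<^const>\<open>partition_on\<close>; otherwise a covering could be
  prolonged by empty sets without bound.
\<close>

definition covering :: "('a, 'b) pre_digraph \<Rightarrow> 'a set list \<Rightarrow> bool" where
  "covering G Is \<longleftrightarrow>
     distinct Is \<and> partition_on (verts G) (set Is) \<and>
     (\<forall>I\<in>set Is. independent_set G I) \<and>
     (\<forall>i<length Is. maximal_independent (G \<restriction> \<Union> (set (drop i Is))) (Is ! i))"

definition chi_dot :: "('a, 'b) pre_digraph \<Rightarrow> nat" where
  "chi_dot G = Max {length Is | Is. covering G Is}"

definition hom_cells :: "('a, 'b) pre_digraph \<Rightarrow> nat \<Rightarrow> ('a \<Rightarrow> nat set) set" where
  "hom_cells G n =
     {\<eta> \<in> verts G \<rightarrow>\<^sub>E (Pow {1..n} - {{}}). \<forall>u v. u \<rightarrow>\<^bsub>G\<^esub> v \<longrightarrow> \<eta> u \<inter> \<eta> v = {}}"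

definition simplex_on :: "nat set \<Rightarrow> (nat \<Rightarrow> real) set" where
  "simplex_on S = {x. (\<forall>i. 0 \<le> x i) \<and> (\<forall>i. i \<notin> S \<longrightarrow> x i = 0) \<and> (\<Sum>i\<in>S. x i) = 1}"

definition closed_cell :: "('a, 'b) pre_digraph \<Rightarrow> ('a \<Rightarrow> nat set) \<Rightarrow> ('a \<Rightarrow> nat \<Rightarrow> real) set" where
  "closed_cell G \<eta> = (\<Pi>\<^sub>E v\<in>verts G. simplex_on (\<eta> v))"

text \<open>
  The complex Hom(G, K_n) as a space: the union of its closed cells inside a product of copies of
  the simplex on the vertices \<open>1, \<dots>, n\<close>, one for each vertex of G. There
  \<open>closed_cell G \<eta>' \<subseteq> closed_cell G \<eta>\<close> holds iff \<open>\<eta>' v \<subseteq> \<eta> v\<close> for all v, and the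
  intersection of two closed cells is empty or the closed cell of the pointwise intersection, so
  the faces are the prescribed ones. As there are finitely many cells, the subspace topology is
  the topology of the cell complex.
\<close>

definition Hom_complex :: "('a, 'b) pre_digraph \<Rightarrow> nat \<Rightarrow> ('a \<Rightarrow> nat \<Rightarrow> real) topology" where
  "Hom_complex G n =
     subtopology (product_topology (\<lambda>_. powertop_real UNIV) (verts G))
       (\<Union>\<eta>\<in>hom_cells G n. closed_cell G \<eta>)"

definition nsphere_base :: "nat \<Rightarrow> real" where
  "nsphere_base = (\<lambda>k. if k = 0 then 1 else 0)"

text \<open>
  The underlying set of \<open>\<pi>\<^sub>i(X, b)\<close>: classes of maps \<open>(S\<^sup>i, p) \<rightarrow> (X, b)\<close> modulo homotopies
  that keep the base point fixed. For \<open>i = 0\<close> this is the set of path components of X.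
\<close>

definition homotopy_set :: "nat \<Rightarrow> 'a topology \<Rightarrow> 'a \<Rightarrow> ((nat \<Rightarrow> real) \<Rightarrow> 'a) set set" where
  "homotopy_set i X b =
     {f. continuous_map (nsphere i) X f \<and> f nsphere_base = b} //
     {(f, g). homotopic_with (\<lambda>h. h nsphere_base = b) (nsphere i) X f g}"

text \<open>
  The homotopy sets are pointed by the class of the constant map, so vanishing means having
  exactly one element. The integer m may be negative.
\<close>

definition m_connected :: "int \<Rightarrow> 'a topology \<Rightarrow> bool" where
  "m_connected m X \<longleftrightarrow>
     (m \<ge> -1 \<longrightarrow> topspace X \<noteq> {}) \<and>
     (\<forall>i. int i \<le> m \<longrightarrow> (\<forall>b\<in>topspace X. is_singleton (homotopy_set i X b)))"

end

theory Submission
  imports Defs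
begin

text \<open>
  Call a space X a d-extensor if maps to X extend from closed \<open>L \<subseteq> Z\<close> to Z whenever Z lies in
  Euclidean space and \<open>dim (Z - L) < d\<close>; such spaces are (d-2)-connected. A union of two closed
  d-extensors that meet in a (d-1)-extensor is a d-extensor, because the preimages of the two sets
  can be separated in Z by a closed set of smaller dimension.

  For an independent set I, let \<open>X\<^sub>I\<close> be the part of Hom(G, K_n) where colour n is used on I only.
  It deforms onto Hom(G - I, K_(n-1)) by giving I colour n. The \<open>X\<^sub>I\<close> with I maximal cover
  Hom(G, K_n), and \<open>X\<^sub>I \<inter> X\<^sub>J = X\<^sub>K\<close> for \<open>K = I \<inter> J\<close>. Writing c for the maximal length of a
  covering, \<open>c(G - I) < c(G)\<close> for I maximal and \<open>c(G - I) \<le> c(G)\<close> for all I. By induction on n the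
  \<open>X\<^sub>I\<close> with I maximal are (n+1-c(G))-extensors and their intersections (n-c(G))-extensors.
\<close>

section \<open>Partitions in Euclidean space\<close>

text \<open>If \<open>q + t = r\<close> with \<open>q\<close> rational and \<open>r\<close> in
  \<open>R\<close>, then \<open>t\<close> is one of countably many differences \<open>r - q\<close>.
  Any other \<open>t\<close> gives a dense translate of the rationals that misses
  \<open>R\<close>.\<close>

lemma countable_dense_avoiding:
  fixes R :: "real set"
  assumes "countable R"
  obtains D where "countable D" "D \<inter> R = {}" "\<forall>a b. a < b \<longrightarrow> (\<exists>d\<in>D. a < d \<and> d < b)"
proof -
  have "countable ((\<lambda>(r, q). r - q) ` (R \<times> \<rat>))"
    using assms countable_rat by blast
  then obtain t where t: "t \<notin> (\<lambda>(r, q). r - q) ` (R \<times> \<rat>)"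
    using uncountable_UNIV_real by (metis UNIV_eq_I)
  show ?thesis
  proof
    show "countable ((\<lambda>q. q + t) ` \<rat>)"
      using countable_rat by blast
    show "(\<lambda>q. q + t) ` \<rat> \<inter> R = {}"
      using t by (force simp: image_iff)
    have "\<exists>d\<in>(\<lambda>q. q + t) ` \<rat>. a < d \<and> d < b" if "a < b" for a b
      using Rats_dense_in_real[of "a - t" "b - t"] that by force
    then show "\<forall>a b. a < b \<longrightarrow> (\<exists>d\<in>(\<lambda>q. q + t) ` \<rat>. a < d \<and> d < b)" by blast
  qed
qed

text \<open>A closed copy of Euclidean \<open>K\<close>-space inside one fixed type, so that
  \<open>abs_extensor\<close> can quantify over all dimensions.\<close>

definition flat_space :: "nat \<Rightarrow> (nat \<Rightarrow> real) set" where
  "flat_space K = {x. \<forall>i\<ge>K. x i = 0}"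

definition obox :: "nat \<Rightarrow> (nat \<Rightarrow> real) \<times> (nat \<Rightarrow> real) \<Rightarrow> (nat \<Rightarrow> real) set" where
  "obox K p = {x. \<forall>i<K. fst p i < x i \<and> x i < snd p i}"

definition clbox :: "nat \<Rightarrow> (nat \<Rightarrow> real) \<times> (nat \<Rightarrow> real) \<Rightarrow> (nat \<Rightarrow> real) set" where
  "clbox K p = {x. \<forall>i<K. fst p i \<le> x i \<and> x i \<le> snd p i}"

lemma open_obox: "open (obox K p)"
proof -
  have "obox K p = (\<Inter>i\<in>{..<K}. {x. fst p i < x i} \<inter> {x. x i < snd p i})"
    by (auto simp: obox_def)
  then show ?thesis
    by (auto intro!: open_INT open_Int open_Collect_less continuous_on_product_coordinates)
qed

lemma closed_clbox: "closed (clbox K p)"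
proof -
  have "clbox K p = (\<Inter>i\<in>{..<K}. {x. fst p i \<le> x i} \<inter> {x. x i \<le> snd p i})"
    by (auto simp: clbox_def)
  then show ?thesis
    by (auto intro!: closed_INT closed_Int closed_Collect_le continuous_on_product_coordinates)
qed

lemma obox_subset_clbox: "obox K p \<subseteq> clbox K p"
  by (auto simp: obox_def clbox_def less_imp_le)

lemma clbox_in_obox_or_face:
  assumes "x \<in> clbox K p" "p \<in> ({..<K} \<rightarrow>\<^sub>E D) \<times> ({..<K} \<rightarrow>\<^sub>E D)"
  shows "x \<in> obox K p \<or> (\<exists>i<K. x i \<in> D)"
proof (rule disjCI)
  assume no: "\<not> (\<exists>i<K. x i \<in> D)"
  have "fst p i < x i \<and> x i < snd p i" if i: "i < K" for i
  proof -
    have "fst p i \<in> D" "snd p i \<in> D" "x i \<notin> D"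
      using assms(2) i no by (auto simp: mem_Times_iff)
    then have "fst p i \<noteq> x i" "x i \<noteq> snd p i"
      by metis+
    moreover have "fst p i \<le> x i" "x i \<le> snd p i"
      using assms(1) i by (simp_all add: clbox_def)
    ultimately show ?thesis by simp
  qed
  then show "x \<in> obox K p"
    by (simp add: obox_def)
qed

text \<open>Shrink the first \<open>K\<close> sides of a basic product neighbourhood of
  \<open>x\<close> to intervals with endpoints in \<open>D\<close>. From coordinate \<open>K\<close>
  on, \<open>x\<close> and the points of \<open>C\<close> are all 0, so the box may leave these
  coordinates free.\<close>

lemma box_separating_point_closed:
  assumes D: "\<forall>a b. a < b \<longrightarrow> (\<exists>d\<in>D. a < d \<and> d < (b::real))"
    and "closed C" "C \<subseteq> flat_space K" "x \<in> flat_space K" "x \<notin> C"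
  obtains p where "p \<in> ({..<K} \<rightarrow>\<^sub>E D) \<times> ({..<K} \<rightarrow>\<^sub>E D)" "x \<in> obox K p" "clbox K p \<inter> C = {}"
proof -
  have "openin (product_topology (\<lambda>i. euclidean) UNIV) (- C)"
    using \<open>closed C\<close> by (simp add: euclidean_product_topology open_Compl)
  then obtain X where X: "x \<in> Pi\<^sub>E UNIV X" "\<And>i. open (X i)" "Pi\<^sub>E UNIV X \<subseteq> - C"
    using product_topology_open_contains_basis[of "\<lambda>i. euclidean" UNIV "- C" x] \<open>x \<notin> C\<close>
    by auto
  have "\<exists>a b. a \<in> D \<and> b \<in> D \<and> a < x i \<and> x i < b \<and> {a..b} \<subseteq> X i" for i
  proof -
    have "x i \<in> X i" using X(1) by auto
    then obtain e where e: "e > 0" "ball (x i) e \<subseteq> X i"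
      using X(2)[of i] by (meson openE)
    obtain a where "a \<in> D" "x i - e < a" "a < x i" using D[rule_format, of "x i - e" "x i"] e by auto
    moreover obtain b where "b \<in> D" "x i < b" "b < x i + e" using D[rule_format, of "x i" "x i + e"] e by auto
    ultimately show ?thesis using e(2)
      by (intro exI[of _ a] exI[of _ b]) (auto simp: ball_def dist_real_def abs_if subset_iff)
  qed
  then obtain a b where ab: "\<And>i. a i \<in> D" "\<And>i. b i \<in> D" "\<And>i. a i < x i" "\<And>i. x i < b i"
    "\<And>i. {a i..b i} \<subseteq> X i"
    by metis
  define p where "p = (restrict a {..<K}, restrict b {..<K})"
  show ?thesis
  proof
    show "p \<in> ({..<K} \<rightarrow>\<^sub>E D) \<times> ({..<K} \<rightarrow>\<^sub>E D)" "x \<in> obox K p"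
      using ab by (auto simp: p_def obox_def)
    show "clbox K p \<inter> C = {}"
    proof (rule ccontr)
      assume "clbox K p \<inter> C \<noteq> {}"
      then obtain y where y: "y \<in> clbox K p" "y \<in> C" by blast
      have "y i \<in> X i" for i
      proof (cases "i < K")
        case True
        then show ?thesis using y(1) ab(5)[of i] by (auto simp: clbox_def p_def)
      next
        case False
        then have "y i = x i" using assms y(2) by (auto simp: flat_space_def)
        then show ?thesis using X(1) by auto
      qed
      then show False using X(3) y(2) by auto
    qed
  qed
qed

text \<open>
  The open sets separating \<open>A\<close> from \<open>B\<close> are assembled from an enumeration of the boxes with
  endpoints in a fresh countable dense set, so every point of the partition lies on a box face.
\<close>

lemma partition_with_fresh_coordinates:
  assumes "closed Z" "closed A" "closed B" "A \<subseteq> Z" "B \<subseteq> Z" "Z \<subseteq> flat_space K" "countable R"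
  obtains P Q D where "closed P" "closed Q" "P \<union> Q = Z" "P \<inter> (A \<union> B) = A" "Q \<inter> (A \<union> B) = B"
    "countable D" "D \<inter> R = {}" "\<And>x. x \<in> P \<inter> Q - A \<inter> B \<Longrightarrow> \<exists>i<K. x i \<in> D"
proof -
  obtain D where D: "countable D" "D \<inter> R = {}" "\<forall>a b. a < b \<longrightarrow> (\<exists>d\<in>D. a < d \<and> d < b)"
    using countable_dense_avoiding[OF \<open>countable R\<close>] by metis
  define \<B> where "\<B> = ({..<K} \<rightarrow>\<^sub>E D) \<times> ({..<K} \<rightarrow>\<^sub>E D)"
  have "countable \<B>"
    unfolding \<B>_def using D(1) by (intro countable_SIGMA countable_PiE) auto
  define \<beta> where "\<beta> = from_nat_into \<B>"
  \<comment> \<open>A box whose closure misses both sets counts as \<open>tA\<close> only, so the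
    two kinds exclude each other.\<close>
  define tA where "tA n \<longleftrightarrow> \<beta> n \<in> \<B> \<and> clbox K (\<beta> n) \<inter> B = {}" for n
  define tB where "tB n \<longleftrightarrow> \<beta> n \<in> \<B> \<and> clbox K (\<beta> n) \<inter> A = {} \<and> \<not> tA n" for n
  \<comment> \<open>From each box the earlier closed boxes of the other kind are removed. They are
    finitely many, so openness survives, and where boxes of different kinds meet, the later one
    gives way. Points of \<open>A \<inter> B\<close> end up in neither set.\<close>
  define VA where "VA = (\<Union>n\<in>{n. tA n}. obox K (\<beta> n) - (\<Union>j\<in>{j. j < n \<and> tB j}. clbox K (\<beta> j)))"
  define VB where "VB = (\<Union>n\<in>{n. tB n}. obox K (\<beta> n) - (\<Union>j\<in>{j. j < n \<and> tA j}. clbox K (\<beta> j)))"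
  have "open VA" "open VB"
    unfolding VA_def VB_def
    by (intro open_UN ballI open_Diff open_obox closed_UN closed_clbox; simp)+
  have disj: "VA \<inter> VB = {}"
  proof (rule ccontr)
    assume "VA \<inter> VB \<noteq> {}"
    then obtain x n m where "x \<in> obox K (\<beta> n)" "x \<in> obox K (\<beta> m)" "tA n" "tB m"
      "\<And>j. j < n \<Longrightarrow> tB j \<Longrightarrow> x \<notin> clbox K (\<beta> j)" "\<And>j. j < m \<Longrightarrow> tA j \<Longrightarrow> x \<notin> clbox K (\<beta> j)"
      unfolding VA_def VB_def by blast
    moreover from this have "n \<noteq> m" by (auto simp: tB_def)
    ultimately show False
      using obox_subset_clbox[of K] by (meson linorder_neqE_nat subsetD)
  qed
  have subA: "A \<subseteq> flat_space K" and subB: "B \<subseteq> flat_space K"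
    and flat: "\<And>x. x \<in> Z \<Longrightarrow> x \<in> flat_space K"
    using assms(4-6) by auto
  have boxA: "\<exists>n. tA n \<and> x \<in> obox K (\<beta> n)" if x: "x \<in> Z" "x \<notin> B" for x
  proof -
    obtain p where "p \<in> \<B>" "x \<in> obox K p" "clbox K p \<inter> B = {}"
      unfolding \<B>_def
      using box_separating_point_closed[OF D(3) \<open>closed B\<close> subB flat[OF x(1)] x(2)] .
    then show ?thesis
      using from_nat_into_surj[OF \<open>countable \<B>\<close>, of p] by (auto simp: tA_def \<beta>_def)
  qed
  have boxB: "\<exists>n. (tA n \<or> tB n) \<and> x \<in> obox K (\<beta> n)" if x: "x \<in> Z" "x \<notin> A" for x
  proof -
    obtain p where "p \<in> \<B>" "x \<in> obox K p" "clbox K p \<inter> A = {}"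
      unfolding \<B>_def
      using box_separating_point_closed[OF D(3) \<open>closed A\<close> subA flat[OF x(1)] x(2)] .
    then show ?thesis
      using from_nat_into_surj[OF \<open>countable \<B>\<close>, of p] by (auto simp: tB_def \<beta>_def)
  qed
  have "tB n \<Longrightarrow> obox K (\<beta> n) \<inter> A = {}" "tA n \<Longrightarrow> obox K (\<beta> n) \<inter> B = {}" for n
    using obox_subset_clbox[of K "\<beta> n"] by (auto simp: tA_def tB_def)
  then have noA: "VB \<inter> A = {}" and noB: "VA \<inter> B = {}"
    unfolding VA_def VB_def by blast+
  have coverA: "x \<in> VA" if x: "x \<in> A - B" for x
  proof -
    obtain n where "tA n" "x \<in> obox K (\<beta> n)" using boxA[of x] x \<open>A \<subseteq> Z\<close> by blast
    moreover have "x \<notin> clbox K (\<beta> j)" if "tB j" for j using that x by (auto simp: tB_def)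
    ultimately show ?thesis by (auto simp: VA_def)
  qed
  have coverB: "x \<in> VB" if x: "x \<in> B - A" for x
  proof -
    obtain n where n: "tA n \<or> tB n" "x \<in> obox K (\<beta> n)" using boxB[of x] x \<open>B \<subseteq> Z\<close> by blast
    have no: "x \<notin> clbox K (\<beta> j)" if "tA j" for j using that x by (auto simp: tA_def)
    then have "tB n" using n obox_subset_clbox[of K] by blast
    then show ?thesis using no n by (auto simp: VB_def)
  qed
  have face: "\<exists>i<K. x i \<in> D" if x: "x \<in> Z - VA - VB - A \<inter> B" for x
  proof -
    have "\<exists>n. (tA n \<or> tB n) \<and> x \<in> clbox K (\<beta> n)"
      using boxA[of x] boxB[of x] x obox_subset_clbox[of K] by blast
    \<comment> \<open>Take the first box whose closure contains \<open>x\<close>. No earlier box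
      removes \<open>x\<close> from it, so an interior point would lie in \<open>VA\<close> or
      \<open>VB\<close>; hence \<open>x\<close> is on a face.\<close>
    then obtain n where n: "tA n \<or> tB n" "x \<in> clbox K (\<beta> n)"
      and least: "\<And>j. j < n \<Longrightarrow> \<not> ((tA j \<or> tB j) \<and> x \<in> clbox K (\<beta> j))"
      using exists_least_iff[of "\<lambda>n. (tA n \<or> tB n) \<and> x \<in> clbox K (\<beta> n)"] by auto
    have "x \<notin> obox K (\<beta> n)"
      using n least x by (auto simp: VA_def VB_def)
    moreover have "\<beta> n \<in> \<B>"
      using n(1) by (auto simp: tA_def tB_def)
    ultimately show ?thesis
      using clbox_in_obox_or_face[OF n(2), of D] by (auto simp: \<B>_def)
  qed
  show ?thesis
  proof
    show "closed (Z - VB)" "closed (Z - VA)"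
      using \<open>closed Z\<close> \<open>open VA\<close> \<open>open VB\<close> by auto
    show "Z - VB \<union> (Z - VA) = Z" using disj by auto
    show "(Z - VB) \<inter> (A \<union> B) = A" "(Z - VA) \<inter> (A \<union> B) = B"
      using noA noB coverA coverB assms(4,5) by blast+
  qed (use D(1,2) face in auto)
qed

section \<open>Absolute extensors\<close>

text \<open>
  Absolute extensors for pairs \<open>(Z, L)\<close> in Euclidean space with \<open>dim (Z - L) < d\<close>. The dimension
  bound is witnessed by a countable set \<open>R\<close>: each point of \<open>Z - L\<close> lies on a flat of dimension
  less than \<open>d\<close> that is cut out by coordinate equations with right-hand sides in \<open>R\<close>.
\<close>

definition abs_extensor :: "nat \<Rightarrow> 'c topology \<Rightarrow> bool" where
  "abs_extensor d X \<longleftrightarrow> (\<forall>K Z L R f.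
     closed Z \<and> closed L \<and> L \<subseteq> Z \<and> Z \<subseteq> flat_space K \<and> countable R \<and>
     (\<forall>x\<in>Z - L. K < card {i. i < K \<and> x i \<in> R} + d) \<and>
     continuous_map (top_of_set L) X f \<longrightarrow>
     (\<exists>F. continuous_map (top_of_set Z) X F \<and> (\<forall>x\<in>L. F x = f x)))"

lemma abs_extensorD:
  assumes "abs_extensor d X" "closed Z" "closed L" "L \<subseteq> Z" "Z \<subseteq> flat_space K" "countable R"
    "\<And>x. x \<in> Z - L \<Longrightarrow> K < card {i. i < K \<and> x i \<in> R} + d"
    "continuous_map (top_of_set L) X f"
  obtains F where "continuous_map (top_of_set Z) X F" "\<And>x. x \<in> L \<Longrightarrow> F x = f x"
proof -
  have "\<exists>F. continuous_map (top_of_set Z) X F \<and> (\<forall>x\<in>L. F x = f x)"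
    using assms(1)[unfolded abs_extensor_def, rule_format, of Z L K R f] assms(2-) by blast
  then show ?thesis using that by blast
qed

lemma abs_extensor_mono:
  assumes "abs_extensor d X" "e \<le> d"
  shows "abs_extensor e X"
  unfolding abs_extensor_def
proof (intro allI impI, elim conjE)
  fix K Z L R f
  assume "closed Z" "closed L" "L \<subseteq> Z" "Z \<subseteq> flat_space K" "countable R"
    and e: "\<forall>x\<in>Z - L. K < card {i. i < K \<and> x i \<in> R} + e"
    and "continuous_map (top_of_set L) X f"
  moreover have "K < card {i. i < K \<and> x i \<in> R} + d" if "x \<in> Z - L" for x
    using bspec[OF e that] assms(2) by linarith
  ultimately show "\<exists>F. continuous_map (top_of_set Z) X F \<and> (\<forall>x\<in>L. F x = f x)"
    using assms(1)[unfolded abs_extensor_def, rule_format, of Z L K R f] by blast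
qed

text \<open>In degree 0 the dimension bound is negative, which forces \<open>Z = L\<close>.\<close>

lemma abs_extensor_0: "abs_extensor 0 X"
  unfolding abs_extensor_def
proof (intro allI impI, elim conjE)
  fix K Z L and R :: "real set" and f
  assume dim: "\<forall>x\<in>Z - L. K < card {i. i < K \<and> x i \<in> R} + 0" and "L \<subseteq> Z"
    and f: "continuous_map (top_of_set L) X f"
  have "card {i. i < K \<and> x i \<in> R} \<le> K" for x :: "nat \<Rightarrow> real"
    using card_mono[of "{..<K}" "{i. i < K \<and> x i \<in> R}"] by auto
  then have "Z = L"
    using dim \<open>L \<subseteq> Z\<close> by (metis DiffI add_0_right leD subsetI subset_antisym)
  then show "\<exists>F. continuous_map (top_of_set Z) X F \<and> (\<forall>x\<in>L. F x = f x)"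
    using f by blast
qed

section \<open>Unions of closed extensors\<close>

lemma continuous_map_paste_closed:
  assumes "closed S" "closed T"
    and f: "continuous_map (top_of_set S) X f" and g: "continuous_map (top_of_set T) X g"
    and eq: "\<And>x. x \<in> S \<inter> T \<Longrightarrow> f x = g x"
  shows "continuous_map (top_of_set (S \<union> T)) X (\<lambda>x. if x \<in> S then f x else g x)"
proof (rule pasting_lemma_closed[where I = "UNIV :: bool set" and T = "\<lambda>b. if b then S else T"
      and f = "\<lambda>b. if b then f else g"])
  show "closedin (top_of_set (S \<union> T)) (if b then S else T)" for b
    using assms(1,2) by (auto intro!: closed_subset)
  show "continuous_map (subtopology (top_of_set (S \<union> T)) (if b then S else T)) X (if b then f else g)" for b
    using f g by (auto simp: subtopology_subtopology Int_absorb1)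
  show "(if b then f else g) x = (if c then f else g) x"
    if "x \<in> topspace (top_of_set (S \<union> T)) \<inter> (if b then S else T) \<inter> (if c then S else T)" for b c x
    using that eq[of x] by (cases b; cases c) auto
  show "\<exists>b. b \<in> UNIV \<and> x \<in> (if b then S else T) \<and>
      (if x \<in> S then f x else g x) = (if b then f else g) x" if "x \<in> topspace (top_of_set (S \<union> T))" for x
    using that by (intro exI[of _ "x \<in> S"]) auto
qed simp

text \<open>A point on a box face gains a coordinate in the fresh set \<open>D\<close>, so its flat
  loses a dimension. This pays for the drop from \<open>d\<close> to \<open>d - 1\<close> on a
  partition.\<close>

lemma card_fresh_coordinate:
  fixes i K :: nat
  assumes "i < K" "x i \<in> D" "D \<inter> R = {}"
  shows "card {i. i < K \<and> x i \<in> R} < card {i. i < K \<and> x i \<in> R \<union> D}"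
proof (rule psubset_card_mono)
  have "i \<in> {i. i < K \<and> x i \<in> R \<union> D}" "i \<notin> {i. i < K \<and> x i \<in> R}"
    using assms by blast+
  then show "{i. i < K \<and> x i \<in> R} \<subset> {i. i < K \<and> x i \<in> R \<union> D}"
    by blast
qed simp

text \<open>
  Given \<open>f : L \<rightarrow> A \<union> B\<close>, extend the splitting of \<open>L\<close> into the preimages of \<open>A\<close> and \<open>B\<close> to a
  splitting \<open>Z = P \<union> Q\<close> along a partition \<open>P \<inter> Q\<close> of smaller dimension; extend first to \<open>P \<inter> Q \<rightarrow> A \<inter> B\<close>, then to \<open>P \<rightarrow> A\<close> and \<open>Q \<rightarrow> B\<close>.
\<close>

lemma abs_extensor_Un:
  assumes A: "closedin X A" and B: "closedin X B"
    and AE: "abs_extensor d (subtopology X A)" "abs_extensor d (subtopology X B)"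
      "abs_extensor (d - 1) (subtopology X (A \<inter> B))"
  shows "abs_extensor d (subtopology X (A \<union> B))"
\<comment> \<open>For \<open>d = 0\<close> truncation gives \<open>d - 1 = 0\<close>, so the degree
  cannot drop; every space is a 0-extensor anyway.\<close>
proof (cases "d = 0")
  case True
  then show ?thesis by (simp add: abs_extensor_0)
next
  case False
  show ?thesis
    unfolding abs_extensor_def
  proof (intro allI impI, elim conjE)
    fix K Z L and R :: "real set" and f
    assume Z: "closed Z" and L: "closed L" "L \<subseteq> Z" and ZK: "Z \<subseteq> flat_space K" and R: "countable R"
      and dim: "\<forall>x\<in>Z - L. K < card {i. i < K \<and> x i \<in> R} + d"
      and f: "continuous_map (top_of_set L) (subtopology X (A \<union> B)) f"
    have fX: "continuous_map (top_of_set L) X f" and fAB: "\<And>x. x \<in> L \<Longrightarrow> f x \<in> A \<union> B"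
      using f by (auto simp: continuous_map_in_subtopology)
    define LA where "LA = {x\<in>L. f x \<in> A}"
    define LB where "LB = {x\<in>L. f x \<in> B}"
    have "closedin (top_of_set L) LA" "closedin (top_of_set L) LB"
      using closedin_continuous_map_preimage[OF fX A] closedin_continuous_map_preimage[OF fX B]
      by (auto simp: LA_def LB_def)
    then have cl: "closed LA" "closed LB"
      using L(1) closedin_closed_trans by blast+
    have LAB: "LA \<union> LB = L" using fAB by (auto simp: LA_def LB_def)
    obtain P Q D where PQ: "closed P" "closed Q" "P \<union> Q = Z" "P \<inter> L = LA" "Q \<inter> L = LB"
      and D: "countable D" "D \<inter> R = {}" "\<And>x. x \<in> P \<inter> Q - LA \<inter> LB \<Longrightarrow> \<exists>i<K. x i \<in> D"
      using partition_with_fresh_coordinates[OF Z cl _ _ ZK R] L(2) LAB by (metis Un_subset_iff)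
    have fsub: "continuous_map (top_of_set M) (subtopology X C) f"
      if "M \<subseteq> L" "f ` M \<subseteq> C" for M C
      using continuous_map_from_subtopology_mono[OF fX that(1)] that(2)
      by (auto simp: continuous_map_in_subtopology)
    obtain g where g: "continuous_map (top_of_set (P \<inter> Q)) (subtopology X (A \<inter> B)) g"
      and gf: "\<And>x. x \<in> LA \<inter> LB \<Longrightarrow> g x = f x"
    proof (rule abs_extensorD[OF AE(3), of "P \<inter> Q" "LA \<inter> LB" K "R \<union> D" f])
      show "K < card {i. i < K \<and> x i \<in> R \<union> D} + (d - 1)" if x: "x \<in> P \<inter> Q - LA \<inter> LB" for x
      proof -
        \<comment> \<open>A point of \<open>P \<inter> Q\<close> in \<open>L\<close> would lie in
          both \<open>LA\<close> and \<open>LB\<close>.\<close>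
        have "x \<in> Z - L" using x PQ by blast
        then have "K < card {i. i < K \<and> x i \<in> R} + d" using dim by blast
        moreover obtain i where "i < K" "x i \<in> D" using D(3)[OF x] by blast
        ultimately show ?thesis
          using card_fresh_coordinate[of i K x D R] D(2) False by linarith
      qed
      show "continuous_map (top_of_set (LA \<inter> LB)) (subtopology X (A \<inter> B)) f"
        by (rule fsub) (auto simp: LA_def LB_def)
    qed (use PQ cl ZK R D in auto)
    \<comment> \<open>Both sides are treated alike: \<open>S\<close> is \<open>P\<close> or
      \<open>Q\<close>, \<open>C\<close> its target and \<open>M = S \<inter> L\<close>. Paste
      \<open>f\<close> on \<open>M\<close> with \<open>g\<close> on the partition, then extend over
      \<open>S\<close>.\<close>
    have half: "\<exists>F. continuous_map (top_of_set S) (subtopology X C) F \<and>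
        (\<forall>x\<in>M. F x = f x) \<and> (\<forall>x\<in>P \<inter> Q. F x = g x)"
      if AEC: "abs_extensor d (subtopology X C)" and C: "A \<inter> B \<subseteq> C" "f ` M \<subseteq> C"
        and S: "closed S" "S \<subseteq> Z" "P \<inter> Q \<subseteq> S" and M: "closed M" "S \<inter> L = M" "M \<inter> (P \<inter> Q) \<subseteq> LA \<inter> LB"
      for S M C
    proof -
      let ?h = "\<lambda>x. if x \<in> M then f x else g x"
      have h: "continuous_map (top_of_set (M \<union> (P \<inter> Q))) (subtopology X C) ?h"
      proof (rule continuous_map_paste_closed)
        show "continuous_map (top_of_set M) (subtopology X C) f"
          using M C by (intro fsub) auto
        show "continuous_map (top_of_set (P \<inter> Q)) (subtopology X C) g"
          using g \<open>A \<inter> B \<subseteq> C\<close> by (auto simp: continuous_map_in_subtopology)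
        show "f x = g x" if "x \<in> M \<inter> (P \<inter> Q)" for x
          using subsetD[OF M(3) that] gf[of x] by simp
      qed (use M PQ in auto)
      have dimS: "\<And>x. x \<in> S - (M \<union> (P \<inter> Q)) \<Longrightarrow> K < card {i. i < K \<and> x i \<in> R} + d"
        using dim S M by blast
      have clM: "closed (M \<union> (P \<inter> Q))" and subM: "M \<union> (P \<inter> Q) \<subseteq> S" and SK: "S \<subseteq> flat_space K"
        using S M PQ(1,2) ZK by auto
      obtain F where F: "continuous_map (top_of_set S) (subtopology X C) F"
        "\<And>x. x \<in> M \<union> (P \<inter> Q) \<Longrightarrow> F x = ?h x"
        by (rule abs_extensorD[OF AEC S(1) clM subM SK R dimS h], assumption, rule that)
      have "F x = g x" if "x \<in> P \<inter> Q" for x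
        using F(2)[of x] that gf[of x] subsetD[OF M(3), of x] by auto
      then show ?thesis using F by (intro exI[of _ F]) auto
    qed
    obtain FA where FA: "continuous_map (top_of_set P) (subtopology X A) FA"
      "\<forall>x\<in>LA. FA x = f x" "\<forall>x\<in>P \<inter> Q. FA x = g x"
    proof -
      have "f ` LA \<subseteq> A" by (auto simp: LA_def)
      then have "\<exists>F. continuous_map (top_of_set P) (subtopology X A) F \<and>
          (\<forall>x\<in>LA. F x = f x) \<and> (\<forall>x\<in>P \<inter> Q. F x = g x)"
        by (intro half AE(1)) (use PQ cl in auto)
      then show ?thesis using that by blast
    qed
    obtain FB where FB: "continuous_map (top_of_set Q) (subtopology X B) FB"
      "\<forall>x\<in>LB. FB x = f x" "\<forall>x\<in>P \<inter> Q. FB x = g x"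
    proof -
      have "f ` LB \<subseteq> B" by (auto simp: LB_def)
      then have "\<exists>F. continuous_map (top_of_set Q) (subtopology X B) F \<and>
          (\<forall>x\<in>LB. F x = f x) \<and> (\<forall>x\<in>P \<inter> Q. F x = g x)"
        by (intro half AE(2)) (use PQ cl in auto)
      then show ?thesis using that by blast
    qed
    have "continuous_map (top_of_set (P \<union> Q)) (subtopology X (A \<union> B)) (\<lambda>x. if x \<in> P then FA x else FB x)"
      by (rule continuous_map_paste_closed)
        (use PQ FA FB in \<open>auto simp: continuous_map_in_subtopology\<close>)
    then show "\<exists>F. continuous_map (top_of_set Z) (subtopology X (A \<union> B)) F \<and> (\<forall>x\<in>L. F x = f x)"
      using PQ FA(2) FB(2) LAB by (intro exI conjI) auto
  qed
qed

text \<open>Split off one set \<open>S I\<close>. It meets the union of the others in the union of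
  the sets \<open>S (J \<inter> I)\<close>. This is a smaller family indexed in \<open>\<I>\<close>,
  so by induction its union is a \<open>(d - 1)\<close>-extensor.\<close>

lemma abs_extensor_UNION:
  assumes "finite F" "F \<noteq> {}" "F \<subseteq> \<I>"
    and S: "\<And>I. I \<in> \<I> \<Longrightarrow> closedin X (S I)" "\<And>I J. I \<in> \<I> \<Longrightarrow> J \<in> \<I> \<Longrightarrow> I \<inter> J \<in> \<I>"
      "\<And>I J. I \<in> \<I> \<Longrightarrow> J \<in> \<I> \<Longrightarrow> S I \<inter> S J = S (I \<inter> J)"
    and AE: "\<And>I. I \<in> F \<Longrightarrow> abs_extensor d (subtopology X (S I))"
      "\<And>I. I \<in> \<I> \<Longrightarrow> abs_extensor (d - 1) (subtopology X (S I))"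
  shows "abs_extensor d (subtopology X (\<Union>I\<in>F. S I))"
  using assms(1-3) AE
\<comment> \<open>The intersections need not be indexed in \<open>F\<close>, so the induction is on
  the number of sets, with \<open>F\<close> and \<open>d\<close> arbitrary.\<close>
proof (induction "card F" arbitrary: F d rule: less_induct)
  case less
  then obtain I F' where F: "F = insert I F'" "I \<notin> F'"
    by (metis Set.set_insert ex_in_conv)
  have fin: "finite F'" and sub: "I \<in> \<I>" "F' \<subseteq> \<I>" and card: "card F' < card F"
    using less.prems F by auto
  show ?case
  proof (cases "F' = {}")
    case True
    then show ?thesis using less.prems F by simp
  next
    case False
    let ?G = "(\<lambda>J. J \<inter> I) ` F'"
    have "abs_extensor d (subtopology X ((\<Union>J\<in>F'. S J) \<union> S I))"
    proof (rule abs_extensor_Un)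
      show "closedin X (\<Union>J\<in>F'. S J)"
        using fin sub S(1) by (intro closedin_Union) auto
      show "closedin X (S I)" using S(1) sub by blast
      show "abs_extensor d (subtopology X (\<Union>J\<in>F'. S J))"
        by (rule less.hyps[OF card fin False sub(2)]) (use F less.prems in auto)
      show "abs_extensor d (subtopology X (S I))" using less.prems F by auto
      have "abs_extensor (d - 1) (subtopology X (\<Union>J\<in>?G. S J))"
      proof (rule less.hyps)
        show "card ?G < card F" using card card_image_le[OF fin] by (rule le_less_trans[rotated])
        show "abs_extensor (d - 1 - 1) (subtopology X (S J))" if "J \<in> \<I>" for J
          using abs_extensor_mono[OF less.prems(5)[OF that]] by simp
      qed (use fin False sub S(2) less.prems(5) in auto)
      moreover have "(\<Union>J\<in>F'. S J) \<inter> S I = (\<Union>J\<in>?G. S J)"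
        using S(3) sub by blast
      ultimately show "abs_extensor (d - 1) (subtopology X ((\<Union>J\<in>F'. S J) \<inter> S I))"
        by simp
    qed
    then show ?thesis by (simp add: F Un_commute)
  qed
qed

section \<open>Coverings of induced subgraphs\<close>

lemma dominates_induce_subgraph_iff:
  "u \<rightarrow>\<^bsub>G \<restriction> S\<^esub> v \<longleftrightarrow> u \<rightarrow>\<^bsub>G\<^esub> v \<and> u \<in> S \<and> v \<in> S"
  by (auto simp: arcs_ends_conv)

lemma induce_subgraph_induce: "U \<subseteq> W \<Longrightarrow> (G \<restriction> W) \<restriction> U = G \<restriction> U"
  by (auto simp: induce_subgraph_def)

lemma independent_set_induce_iff:
  "independent_set (G \<restriction> W) S \<longleftrightarrow> S \<subseteq> W \<and> (\<forall>u\<in>S. \<forall>v\<in>S. \<not> u \<rightarrow>\<^bsub>G\<^esub> v)"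
  by (auto simp: independent_set_def dominates_induce_subgraph_iff)

lemma covering_induce_Nil: "covering (G \<restriction> W) [] \<longleftrightarrow> W = {}"
  by (auto simp: covering_def partition_on_def)

text \<open>This recursion drives the inductions on coverings. The tail has union
  \<open>W - I\<close>, and inducing twice is inducing once, so the maximality conditions agree
  index by index.\<close>

lemma covering_induce_Cons:
  "covering (G \<restriction> W) (I # Is) \<longleftrightarrow>
     I \<noteq> {} \<and> maximal_independent (G \<restriction> W) I \<and> covering (G \<restriction> (W - I)) Is"
proof
  assume cov: "covering (G \<restriction> W) (I # Is)"
  then have dist: "distinct Is" "I \<notin> set Is" and part: "partition_on W (insert I (set Is))"
    and ind: "\<And>J. J \<in> set Is \<Longrightarrow> independent_set (G \<restriction> W) J"
    and max: "\<And>i. i < length (I # Is) \<Longrightarrow>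
      maximal_independent ((G \<restriction> W) \<restriction> \<Union> (set (drop i (I # Is)))) ((I # Is) ! i)"
    by (auto simp: covering_def)
  have disj: "disjnt I (\<Union> (set Is))"
    using part dist(2) by (auto simp: partition_on_def disjoint_def disjnt_def)
  then have part': "partition_on (W - I) (set Is)" and I: "I \<subseteq> W" "I \<noteq> {}"
    using part by (auto simp: partition_on_insert)
  have W: "\<Union> (set (I # Is)) = W" and W': "\<Union> (set Is) = W - I"
    using part part' by (auto simp: partition_on_def)
  have "maximal_independent (G \<restriction> W) I"
    using max[of 0] W by (simp add: induce_subgraph_induce)
  moreover have "maximal_independent ((G \<restriction> (W - I)) \<restriction> \<Union> (set (drop i Is))) (Is ! i)"
    if "i < length Is" for i
  proof -
    have "\<Union> (set (drop i Is)) \<subseteq> W - I"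
      using W' set_drop_subset[of i Is] by blast
    then show ?thesis
      using max[of "Suc i"] that by (simp add: induce_subgraph_induce subset_trans[OF _ Diff_subset])
  qed
  moreover have "independent_set (G \<restriction> (W - I)) J" if "J \<in> set Is" for J
    using ind[OF that] that W' by (auto simp: independent_set_induce_iff)
  ultimately show "I \<noteq> {} \<and> maximal_independent (G \<restriction> W) I \<and> covering (G \<restriction> (W - I)) Is"
    using I(2) dist(1) part' by (auto simp: covering_def)
next
  assume R: "I \<noteq> {} \<and> maximal_independent (G \<restriction> W) I \<and> covering (G \<restriction> (W - I)) Is"
  then have I: "I \<noteq> {}" "independent_set (G \<restriction> W) I" "I \<subseteq> W"
    by (auto simp: maximal_independent_def independent_set_def)
  have dist: "distinct Is" and part: "partition_on (W - I) (set Is)"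
    and ind: "\<And>J. J \<in> set Is \<Longrightarrow> independent_set (G \<restriction> (W - I)) J"
    and max: "\<And>i. i < length Is \<Longrightarrow>
      maximal_independent ((G \<restriction> (W - I)) \<restriction> \<Union> (set (drop i Is))) (Is ! i)"
    using R by (auto simp: covering_def)
  have W': "\<Union> (set Is) = W - I"
    using part by (auto simp: partition_on_def)
  then have disj: "disjnt I (\<Union> (set Is))" by (auto simp: disjnt_def)
  have "I \<notin> set Is" using I(1) W' by blast
  have W: "\<Union> (set (I # Is)) = W" using W' I(3) by auto
  have "maximal_independent ((G \<restriction> W) \<restriction> \<Union> (set (drop i (I # Is)))) ((I # Is) ! i)"
    if "i < length (I # Is)" for i
  proof (cases i)
    case 0
    then show ?thesis using R W by (simp add: induce_subgraph_induce)
  next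
    case (Suc j)
    have "\<Union> (set (drop j Is)) \<subseteq> W - I"
      using W' set_drop_subset[of j Is] by blast
    then show ?thesis
      using max[of j] that Suc by (simp add: induce_subgraph_induce subset_trans[OF _ Diff_subset])
  qed
  moreover have "independent_set (G \<restriction> W) J" if "J \<in> set Is" for J
    using ind[OF that] by (auto simp: independent_set_induce_iff)
  moreover have "partition_on W (insert I (set Is))"
    using part I disj by (simp add: partition_on_insert)
  ultimately show "covering (G \<restriction> W) (I # Is)"
    using dist \<open>I \<notin> set Is\<close> I(2) by (auto simp: covering_def)
qed

lemma independent_set_extend_maximal:
  assumes "finite W" "independent_set (G \<restriction> W) I"
  obtains J where "I \<subseteq> J" "maximal_independent (G \<restriction> W) J"
proof -
  have "finite {J. independent_set (G \<restriction> W) J}"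
    by (rule finite_subset[of _ "Pow W"]) (use assms(1) in \<open>auto simp: independent_set_def\<close>)
  then obtain J where "independent_set (G \<restriction> W) J" "I \<subseteq> J"
    "\<And>T. independent_set (G \<restriction> W) T \<Longrightarrow> J \<subseteq> T \<Longrightarrow> J = T"
    using finite_has_maximal2[of "{J. independent_set (G \<restriction> W) J}" I] assms(2) by auto
  then show ?thesis
    using that[of J] unfolding maximal_independent_def by metis
qed

lemma maximal_independent_subset: "maximal_independent (G \<restriction> W) I \<Longrightarrow> I \<subseteq> W"
  by (auto simp: maximal_independent_def independent_set_def)

context loopfree_digraph
begin

text \<open>Without loops every single vertex is independent.\<close>

lemma maximal_independent_nonempty:
  assumes "maximal_independent (G \<restriction> W) I" "W \<noteq> {}"
  shows "I \<noteq> {}"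
proof
  assume "I = {}"
  obtain v where "v \<in> W" using assms(2) by blast
  then have "independent_set (G \<restriction> W) {v}"
    using adj_not_same by (auto simp: independent_set_induce_iff)
  then show False
    using assms(1) \<open>I = {}\<close> by (auto simp: maximal_independent_def)
qed

text \<open>Remove maximal independent sets greedily. Together with finiteness of the set of
  lengths, this makes the \<open>Max\<close> in \<open>chi_dot\<close> an attained value.\<close>

lemma covering_exists:
  assumes "finite W"
  shows "\<exists>Is. covering (G \<restriction> W) Is"
  using assms
proof (induction W rule: finite_psubset_induct)
  case (psubset W)
  show ?case
  proof (cases "W = {}")
    case True
    then show ?thesis using covering_induce_Nil by blast
  next
    case False
    have "independent_set (G \<restriction> W) {}" by (simp add: independent_set_def)
    then obtain I where I: "maximal_independent (G \<restriction> W) I"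
      using independent_set_extend_maximal psubset.hyps by blast
    then have "W - I \<subset> W"
      using maximal_independent_nonempty[OF I False] maximal_independent_subset[OF I] by blast
    then obtain Is where "covering (G \<restriction> (W - I)) Is"
      using psubset.IH by blast
    then have "covering (G \<restriction> W) (I # Is)"
      using I maximal_independent_nonempty[OF I False] by (simp add: covering_induce_Cons)
    then show ?thesis by blast
  qed
qed

text \<open>
  Extend the parts of a covering of \<open>U\<close> greedily to maximal independent sets of what is left of
  \<open>W\<close>; by maximality in \<open>U\<close> they gain no vertices of \<open>U\<close>.
\<close>

lemma covering_extend:
  assumes "covering (G \<restriction> U) Is" "U \<subseteq> W" "finite W"
  shows "\<exists>Js. covering (G \<restriction> W) Js \<and> length Is \<le> length Js"
  using assms
proof (induction Is arbitrary: U W)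
  case Nil
  then show ?case using covering_exists by auto
next
  case (Cons I Is)
  then have I: "I \<noteq> {}" "maximal_independent (G \<restriction> U) I" and Is: "covering (G \<restriction> (U - I)) Is"
    by (auto simp: covering_induce_Cons)
  then have ind: "independent_set (G \<restriction> W) I"
    using Cons.prems(2) by (auto simp: maximal_independent_def independent_set_induce_iff)
  obtain J where J: "I \<subseteq> J" "maximal_independent (G \<restriction> W) J"
    using independent_set_extend_maximal[OF Cons.prems(3) ind] .
  have "independent_set (G \<restriction> U) (J \<inter> U)"
    using J(2) by (auto simp: maximal_independent_def independent_set_induce_iff)
  moreover have "I \<subseteq> J \<inter> U"
    using J(1) maximal_independent_subset[OF I(2)] by blast
  ultimately have "J \<inter> U = I"
    using I(2) by (auto simp: maximal_independent_def)
  then have "U - I \<subseteq> W - J" using Cons.prems(2) by blast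
  then obtain Js where "covering (G \<restriction> (W - J)) Js" "length Is \<le> length Js"
    using Cons.IH[OF Is] Cons.prems(3) by blast
  then have "covering (G \<restriction> W) (J # Js) \<and> length (I # Is) \<le> length (J # Js)"
    using J I(1) by (auto simp: covering_induce_Cons)
  then show ?case by blast
qed

end

section \<open>The covering number of induced subgraphs\<close>

lemma finite_covering_lengths:
  assumes "finite W"
  shows "finite {length Is | Is. covering (G \<restriction> W) Is}"
proof -
  have "finite {Is. set Is \<subseteq> Pow W \<and> distinct Is}"
    using assms by (intro finite_subset_distinct) simp
  moreover have "{Is. covering (G \<restriction> W) Is} \<subseteq> {Is. set Is \<subseteq> Pow W \<and> distinct Is}"
    by (auto simp: covering_def independent_set_def)
  ultimately have "finite {Is. covering (G \<restriction> W) Is}"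
    using finite_subset by blast
  then show ?thesis by (auto simp: setcompr_eq_image)
qed

lemma length_le_chi_dot:
  "finite W \<Longrightarrow> covering (G \<restriction> W) Is \<Longrightarrow> length Is \<le> chi_dot (G \<restriction> W)"
  unfolding chi_dot_def by (intro Max_ge finite_covering_lengths) auto

context loopfree_digraph
begin

lemma chi_dot_attained:
  assumes "finite W"
  obtains Is where "covering (G \<restriction> W) Is" "length Is = chi_dot (G \<restriction> W)"
proof -
  have "chi_dot (G \<restriction> W) \<in> {length Is | Is. covering (G \<restriction> W) Is}"
    unfolding chi_dot_def using assms covering_exists
    by (intro Max_in finite_covering_lengths) auto
  then show ?thesis using that by auto
qed

lemma chi_dot_induce_mono:
  assumes "finite W" "U \<subseteq> W"
  shows "chi_dot (G \<restriction> U) \<le> chi_dot (G \<restriction> W)"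
proof -
  obtain Is where Is: "covering (G \<restriction> U) Is" "length Is = chi_dot (G \<restriction> U)"
    using chi_dot_attained finite_subset[OF assms(2,1)] .
  then show ?thesis
    using covering_extend[OF Is(1) assms(2,1)] length_le_chi_dot[OF assms(1)] by fastforce
qed

text \<open>Prepend \<open>I\<close>, nonempty since \<open>W\<close> is, to a longest covering of
  \<open>W - I\<close>.\<close>

lemma chi_dot_remove_maximal_independent:
  assumes "finite W" "W \<noteq> {}" "maximal_independent (G \<restriction> W) I"
  shows "chi_dot (G \<restriction> (W - I)) < chi_dot (G \<restriction> W)"
proof -
  obtain Is where Is: "covering (G \<restriction> (W - I)) Is" "length Is = chi_dot (G \<restriction> (W - I))"
    using chi_dot_attained[of "W - I"] assms(1) by auto
  then have "covering (G \<restriction> W) (I # Is)"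
    using assms(2,3) maximal_independent_nonempty by (simp add: covering_induce_Cons)
  then show ?thesis
    using length_le_chi_dot[OF assms(1)] Is(2) by fastforce
qed

end

lemma (in wf_digraph) induce_subgraph_verts_eq: "G \<restriction> verts G = G"
  by (rule pre_digraph.equality) auto

section \<open>Colouring spaces\<close>

text \<open>Points replace cells: the supports at adjacent vertices must be disjoint. With the edges
  as a fixed relation \<open>E\<close>, deleting vertices changes \<open>W\<close> alone.\<close>

definition hom_points :: "('a \<times> 'a) set \<Rightarrow> 'a set \<Rightarrow> nat \<Rightarrow> ('a \<Rightarrow> nat \<Rightarrow> real) set" where
  "hom_points E W n = {x \<in> W \<rightarrow>\<^sub>E simplex_on {1..n}.
     \<forall>u\<in>W. \<forall>v\<in>W. (u, v) \<in> E \<longrightarrow> (\<forall>i. x u i = 0 \<or> x v i = 0)}"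

definition hom_space :: "'a set \<Rightarrow> ('a \<Rightarrow> nat \<Rightarrow> real) set \<Rightarrow> ('a \<Rightarrow> nat \<Rightarrow> real) topology" where
  "hom_space W S = subtopology (product_topology (\<lambda>_. powertop_real UNIV) W) S"

lemma simplex_on_mono:
  assumes "S \<subseteq> T" "finite T"
  shows "simplex_on S \<subseteq> simplex_on T"
proof
  fix x assume x: "x \<in> simplex_on S"
  have "sum x T = sum x S"
    by (rule sum.mono_neutral_right) (use assms x in \<open>auto simp: simplex_on_def\<close>)
  then show "x \<in> simplex_on T"
    using x assms(1) by (auto simp: simplex_on_def)
qed

lemma simplex_on_support:
  assumes "x \<in> simplex_on S" "finite S" "{i. x i \<noteq> 0} \<subseteq> T" "T \<subseteq> S"
  shows "x \<in> simplex_on T"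
proof -
  have "sum x S = sum x T"
    by (rule sum.mono_neutral_right) (use assms in auto)
  then show ?thesis
    using assms by (auto simp: simplex_on_def)
qed

lemma simplex_on_convex:
  assumes "x \<in> simplex_on S" "y \<in> simplex_on S" "0 \<le> c" "c \<le> 1"
  shows "(\<lambda>i. c * x i + (1 - c) * y i) \<in> simplex_on S"
  using assms by (auto simp: simplex_on_def sum.distrib sum_distrib_left[symmetric])

text \<open>The supports of the \<open>x v\<close> form the smallest cell containing
  \<open>x\<close>; conversely the supports of a point of a cell lie inside the sets of that
  cell.\<close>

lemma UNION_closed_cell:
  assumes "wf_digraph G"
  shows "(\<Union>\<eta>\<in>hom_cells G n. closed_cell G \<eta>) = hom_points (arcs_ends G) (verts G) n"
proof (intro subset_antisym subsetI)
  fix x assume "x \<in> (\<Union>\<eta>\<in>hom_cells G n. closed_cell G \<eta>)"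
  then obtain \<eta> where "\<eta> \<in> hom_cells G n" "x \<in> closed_cell G \<eta>"
    by blast
  then have \<eta>: "\<And>v. v \<in> verts G \<Longrightarrow> \<eta> v \<subseteq> {1..n}" "\<And>u v. u \<rightarrow>\<^bsub>G\<^esub> v \<Longrightarrow> \<eta> u \<inter> \<eta> v = {}"
    and x: "x \<in> extensional (verts G)" "\<And>v. v \<in> verts G \<Longrightarrow> x v \<in> simplex_on (\<eta> v)"
    unfolding hom_cells_def closed_cell_def PiE_iff by blast+
  have "x v \<in> simplex_on {1..n}" if "v \<in> verts G" for v
    using simplex_on_mono[OF \<eta>(1)[OF that]] x(2)[OF that] by auto
  moreover have "x u i = 0 \<or> x v i = 0" if "u \<in> verts G" "v \<in> verts G" "u \<rightarrow>\<^bsub>G\<^esub> v" for u v i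
    using \<eta>(2)[OF that(3)] x(2)[OF that(1)] x(2)[OF that(2)] by (auto simp: simplex_on_def)
  ultimately show "x \<in> hom_points (arcs_ends G) (verts G) n"
    using x(1) by (auto simp: hom_points_def PiE_iff)
next
  interpret wf_digraph G by fact
  fix x assume "x \<in> hom_points (arcs_ends G) (verts G) n"
  then have x: "x \<in> extensional (verts G)" "\<And>v. v \<in> verts G \<Longrightarrow> x v \<in> simplex_on {1..n}"
    and E: "\<And>u v i. u \<in> verts G \<Longrightarrow> v \<in> verts G \<Longrightarrow> u \<rightarrow>\<^bsub>G\<^esub> v \<Longrightarrow> x u i = 0 \<or> x v i = 0"
    by (auto simp: hom_points_def PiE_iff)
  define \<eta> where "\<eta> = (\<lambda>v\<in>verts G. {i. x v i \<noteq> 0})"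
  have sub: "{i. x v i \<noteq> 0} \<subseteq> {1..n}" if "v \<in> verts G" for v
    using x(2)[OF that] by (auto simp: simplex_on_def)
  have "x v \<in> simplex_on {i. x v i \<noteq> 0}" if "v \<in> verts G" for v
    using simplex_on_support[OF x(2)[OF that] _ subset_refl sub[OF that]] by simp
  then have "x \<in> closed_cell G \<eta>"
    using x(1) by (auto simp: closed_cell_def PiE_iff \<eta>_def)
  moreover have "\<eta> \<in> hom_cells G n"
    unfolding hom_cells_def
  proof (intro CollectI conjI allI impI PiE_I)
    fix v assume v: "v \<in> verts G"
    have "{i. x v i \<noteq> 0} \<noteq> {}"
    proof
      assume "{i. x v i \<noteq> 0} = {}"
      then have "x v i = 0" for i by blast
      then show False using x(2)[OF v] by (simp add: simplex_on_def)
    qed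
    then show "\<eta> v \<in> Pow {1..n} - {{}}"
      using sub[OF v] v by (simp add: \<eta>_def)
  next
    fix u v assume uv: "u \<rightarrow>\<^bsub>G\<^esub> v"
    then have "u \<in> verts G" "v \<in> verts G" by (auto elim: reachableE)
    then show "\<eta> u \<inter> \<eta> v = {}" using E[OF _ _ uv] by (auto simp: \<eta>_def)
  qed (simp add: \<eta>_def)
  ultimately show "x \<in> (\<Union>\<eta>\<in>hom_cells G n. closed_cell G \<eta>)"
    by blast
qed

lemma Hom_complex_eq_hom_space:
  "wf_digraph G \<Longrightarrow> Hom_complex G n = hom_space (verts G) (hom_points (arcs_ends G) (verts G) n)"
  by (simp add: Hom_complex_def hom_space_def UNION_closed_cell)

lemma topspace_hom_space: "S \<subseteq> extensional W \<Longrightarrow> topspace (hom_space W S) = S"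
  by (auto simp: hom_space_def PiE_def)

lemma hom_points_extensional: "hom_points E W n \<subseteq> extensional W"
  by (auto simp: hom_points_def PiE_iff)

lemma continuous_map_hom_space_coordinate:
  assumes "v \<in> W"
  shows "continuous_map (hom_space W S) euclidean (\<lambda>x. x v i)"
proof -
  have "continuous_map (product_topology (\<lambda>_. powertop_real UNIV) W) euclideanreal ((\<lambda>f. f i) \<circ> (\<lambda>x. x v))"
    using assms by (intro continuous_map_compose[of _ "powertop_real UNIV"] continuous_map_product_coordinates) auto
  then show ?thesis
    by (simp add: hom_space_def o_def continuous_map_from_subtopology)
qed

text \<open>Continuity becomes a condition on single real-valued coordinates, ready for Tietze's
  theorem. Extensionality fixes the values off \<open>W\<close>.\<close>

lemma continuous_map_into_hom_space_iff:
  assumes "S \<subseteq> extensional W"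
  shows "continuous_map (top_of_set Z) (hom_space W S) F \<longleftrightarrow>
    F ` Z \<subseteq> S \<and> (\<forall>v\<in>W. \<forall>i. continuous_on Z (\<lambda>z. F z v i))"
proof (intro iffI conjI ballI allI)
  assume F: "continuous_map (top_of_set Z) (hom_space W S) F"
  show "F ` Z \<subseteq> S"
    using F by (auto simp: hom_space_def continuous_map_in_subtopology)
  show "continuous_on Z (\<lambda>z. F z v i)" if "v \<in> W" for v i
    using continuous_map_compose[OF F continuous_map_hom_space_coordinate[OF that]]
    by (simp add: o_def)
next
  assume F: "F ` Z \<subseteq> S \<and> (\<forall>v\<in>W. \<forall>i. continuous_on Z (\<lambda>z. F z v i))"
  have "continuous_map (top_of_set Z) (product_topology (\<lambda>_. powertop_real UNIV) W) F"
  proof (rule continuous_map_coordinatewise_then_product)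
    show "continuous_map (top_of_set Z) (powertop_real UNIV) (\<lambda>z. F z v)" if "v \<in> W" for v
      using F that by (intro continuous_map_coordinatewise_then_product) auto
    show "F z v = undefined" if "v \<notin> W" "z \<in> topspace (top_of_set Z)" for v z
      using F that assms by (auto simp: extensional_def)
  qed
  then show "continuous_map (top_of_set Z) (hom_space W S) F"
    using F by (auto simp: hom_space_def continuous_map_in_subtopology)
qed

section \<open>Pieces with the last colour confined to a vertex set\<close>

definition hom_points_on :: "('a \<times> 'a) set \<Rightarrow> 'a set \<Rightarrow> nat \<Rightarrow> 'a set \<Rightarrow> ('a \<Rightarrow> nat \<Rightarrow> real) set" where
  "hom_points_on E W n I = {x \<in> hom_points E W n. \<forall>v\<in>W - I. x v n = 0}"

lemma closedin_hom_points_on: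
  assumes "finite W"
  shows "closedin (hom_space W (hom_points E W n)) (hom_points_on E W n I)"
proof -
  let ?X = "hom_space W (hom_points E W n)"
  have top: "topspace ?X = hom_points E W n"
    by (simp add: topspace_hom_space hom_points_extensional)
  have "closedin ?X {x \<in> topspace ?X. x v n \<in> {0}}" if "v \<in> W" for v
    by (rule closedin_continuous_map_preimage[OF continuous_map_hom_space_coordinate[OF that]]) simp
  \<comment> \<open>Inserting the whole space gives the right intersection also when
    \<open>W - I\<close> is empty.\<close>
  then have "closedin ?X (\<Inter> (insert (topspace ?X) ((\<lambda>v. {x \<in> topspace ?X. x v n \<in> {0}}) ` (W - I))))"
    by (intro closedin_Inter) auto
  moreover have "\<Inter> (insert (topspace ?X) ((\<lambda>v. {x \<in> topspace ?X. x v n \<in> {0}}) ` (W - I))) =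
      hom_points_on E W n I"
    unfolding top by (auto simp: hom_points_on_def)
  ultimately show ?thesis by simp
qed

text \<open>
  Pushing the vertices of \<open>I\<close> to the last colour deforms \<open>hom_points_on E W (Suc m) I\<close> onto
  a copy of \<open>hom_points E (W - I) m\<close>. To extend \<open>f\<close>, extend it first to a neighbourhood \<open>L'\<close> of \<open>L\<close>
  (Tietze, then subtract the weights at the neighbouring vertices and renormalise), extend the
  colours below the last one from \<open>L'\<close> to \<open>Z\<close> outside \<open>I\<close>, and run the deformation in the collar.
\<close>

lemma abs_extensor_hom_points_on:
  assumes "finite W" "I \<subseteq> W" "sym E" and I: "\<And>u v. u \<in> I \<Longrightarrow> v \<in> I \<Longrightarrow> (u, v) \<notin> E"
    and AE: "abs_extensor d (hom_space (W - I) (hom_points E (W - I) m))"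
  shows "abs_extensor d (hom_space W (hom_points_on E W (Suc m) I))"
  unfolding abs_extensor_def
proof (intro allI impI, elim conjE)
  fix K Z L and R :: "real set" and f
  assume Z: "closed Z" and L: "closed L" "L \<subseteq> Z" and ZK: "Z \<subseteq> flat_space K" and R: "countable R"
    and dim: "\<forall>x\<in>Z - L. K < card {i. i < K \<and> x i \<in> R} + d"
    and f: "continuous_map (top_of_set L) (hom_space W (hom_points_on E W (Suc m) I)) f"
  have ext: "hom_points_on E W (Suc m) I \<subseteq> extensional W"
    using hom_points_extensional by (auto simp: hom_points_on_def)
  have fc: "\<And>v i. v \<in> W \<Longrightarrow> continuous_on L (\<lambda>z. f z v i)"
    and fS: "\<And>z. z \<in> L \<Longrightarrow> f z \<in> hom_points_on E W (Suc m) I"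
    using f unfolding continuous_map_into_hom_space_iff[OF ext] by auto
  have f_simplex: "\<And>z v. z \<in> L \<Longrightarrow> v \<in> W \<Longrightarrow> f z v \<in> simplex_on {1..Suc m}"
    and f_ext: "\<And>z. z \<in> L \<Longrightarrow> f z \<in> extensional W"
    and f_edge: "\<And>z u v i. z \<in> L \<Longrightarrow> u \<in> W \<Longrightarrow> v \<in> W \<Longrightarrow> (u, v) \<in> E \<Longrightarrow> f z u i = 0 \<or> f z v i = 0"
    and f_last: "\<And>z v. z \<in> L \<Longrightarrow> v \<in> W - I \<Longrightarrow> f z v (Suc m) = 0"
    using fS by (auto simp: hom_points_on_def hom_points_def PiE_iff)
  \<comment> \<open>Each coordinate of \<open>f\<close> is extended separately; the extensions need
    respect neither simplices nor edges.\<close>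
  have "\<exists>y. continuous_on Z y \<and> (\<forall>z\<in>L. y z = f z v i)" if "v \<in> W" for v i
    using Tietze_unbounded[OF fc[OF that, of i] closed_subset[OF L(2,1)]] by metis
  then obtain y where y: "\<And>v i. v \<in> W \<Longrightarrow> continuous_on Z (y v i)"
    "\<And>v i z. v \<in> W \<Longrightarrow> z \<in> L \<Longrightarrow> y v i z = f z v i"
    by metis
  \<comment> \<open>Two adjacent vertices cannot both keep positive weight in a colour, as each
    value would have to exceed the other. Colour \<open>Suc m\<close> survives on \<open>I\<close>
    only.\<close>
  define s where "s z v i = (if i \<in> {1..m} \<or> i = Suc m \<and> v \<in> I
    then max 0 (y v i z - (\<Sum>w\<in>{w\<in>W. (v, w) \<in> E}. \<bar>y w i z\<bar>)) else 0)" for z v i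
  define t where "t z v = (\<Sum>i\<in>{1..Suc m}. s z v i)" for z v
  \<comment> \<open>On \<open>L\<close>, \<open>q\<close> is 0. Where \<open>q \<le> 1 / 2\<close>,
    every total \<open>t\<close> is at least \<open>1 / 2\<close>, so \<open>g\<close> is
    \<open>s\<close> normalised; elsewhere the \<open>max\<close> keeps the quotient continuous. The
    cut-off \<open>c\<close> is 1 on \<open>L\<close> and 0 where
    \<open>q \<ge> 1 / 2\<close>.\<close>
  define q where "q z = (\<Sum>v\<in>W. \<bar>1 - t z v\<bar>)" for z
  define g where "g z v i = s z v i / max (1 / 2) (t z v)" for z v i
  define c where "c z = max 0 (1 - 2 * q z)" for z
  have s_cont: "continuous_on Z (\<lambda>z. s z v i)" if "v \<in> W" for v i
  proof (cases "i \<in> {1..m} \<or> i = Suc m \<and> v \<in> I")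
    case True
    have "continuous_on Z (\<lambda>z. max 0 (y v i z - (\<Sum>w\<in>{w\<in>W. (v, w) \<in> E}. \<bar>y w i z\<bar>)))"
      using that by (auto intro!: continuous_intros y(1))
    then show ?thesis using True by (simp add: s_def)
  next
    case False
    then show ?thesis unfolding s_def by auto
  qed
  have t_cont: "continuous_on Z (\<lambda>z. t z v)" if "v \<in> W" for v
    unfolding t_def by (intro continuous_on_sum s_cont that)
  have q_cont: "continuous_on Z q"
    unfolding q_def by (intro continuous_intros t_cont)
  have g_cont: "continuous_on Z (\<lambda>z. g z v i)" if "v \<in> W" for v i
    unfolding g_def by (intro continuous_on_divide continuous_on_max s_cont t_cont that continuous_on_const) (auto simp: max_def)
  have c_cont: "continuous_on Z c"
    unfolding c_def by (intro continuous_intros q_cont)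
  have s_nonneg: "0 \<le> s z v i" for z v i
    by (auto simp: s_def)
  have s_zero: "s z v i = 0" if "i \<notin> {1..Suc m}" for z v i
    using that by (auto simp: s_def)
  have s_last: "s z v (Suc m) = 0" if "v \<notin> I" for z v
    using that by (auto simp: s_def)
  have s_edge: "s z u i = 0 \<or> s z v i = 0" if uv: "u \<in> W" "v \<in> W" "(u, v) \<in> E" for z u v i
  proof (rule ccontr)
    assume "\<not> ?thesis"
    then have "(\<Sum>w\<in>{w\<in>W. (u, w) \<in> E}. \<bar>y w i z\<bar>) < y u i z"
      "(\<Sum>w\<in>{w\<in>W. (v, w) \<in> E}. \<bar>y w i z\<bar>) < y v i z"
      by (auto simp: s_def split: if_splits)
    moreover have "\<bar>y v i z\<bar> \<le> (\<Sum>w\<in>{w\<in>W. (u, w) \<in> E}. \<bar>y w i z\<bar>)"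
      by (rule member_le_sum) (use uv \<open>finite W\<close> in auto)
    moreover have "\<bar>y u i z\<bar> \<le> (\<Sum>w\<in>{w\<in>W. (v, w) \<in> E}. \<bar>y w i z\<bar>)"
      by (rule member_le_sum) (use uv \<open>finite W\<close> symD[OF \<open>sym E\<close>] in auto)
    ultimately show False by linarith
  qed
  \<comment> \<open>Where \<open>f\<close> has nonzero weight, the weights at adjacent vertices
    vanish, so nothing is subtracted.\<close>
  have s_f: "s z v i = f z v i" if z: "z \<in> L" and v: "v \<in> W" for z v i
  proof (cases "f z v i = 0")
    case True
    have "0 \<le> (\<Sum>w\<in>{w\<in>W. (v, w) \<in> E}. \<bar>y w i z\<bar>)" by (rule sum_nonneg) simp
    then show ?thesis using True y(2)[OF v z] by (simp add: s_def)
  next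
    case False
    have "y w i z = 0" if "w \<in> W" "(v, w) \<in> E" for w
      using y(2)[OF that(1) z, of i] f_edge[OF z v that, of i] False by simp
    then have "(\<Sum>w\<in>{w\<in>W. (v, w) \<in> E}. \<bar>y w i z\<bar>) = 0" by simp
    moreover have "0 \<le> f z v i" "i \<in> {1..Suc m}"
      using f_simplex[OF z v] False by (auto simp: simplex_on_def)
    moreover have "i \<noteq> Suc m \<or> v \<in> I"
      using f_last[OF z, of v] v False by auto
    ultimately show ?thesis using y(2)[OF v z] by (auto simp: s_def)
  qed
  have t_f: "t z v = 1" if "z \<in> L" "v \<in> W" for z v
    using f_simplex[OF that] s_f[OF that] by (simp add: t_def simplex_on_def)
  have g_f: "g z v = f z v" if "z \<in> L" "v \<in> W" for z v
    using s_f[OF that] t_f[OF that] by (auto simp: g_def)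
  have q_f: "q z = 0" if "z \<in> L" for z
    using t_f[OF that] by (simp add: q_def)
  define L' where "L' = {z \<in> Z. q z \<le> 1 / 2}"
  have "closed L'"
    unfolding L'_def using continuous_closed_preimage[OF q_cont Z, of "{..1/2}"] by (simp add: vimage_def Int_def)
  have L': "L \<subseteq> L'" "L' \<subseteq> Z"
    using L(2) q_f by (auto simp: L'_def)
  have t_L': "1 / 2 \<le> t z v" if "z \<in> L'" "v \<in> W" for z v
  proof -
    have "\<bar>1 - t z v\<bar> \<le> q z"
      unfolding q_def by (rule member_le_sum) (use that \<open>finite W\<close> in auto)
    then show ?thesis using that by (auto simp: L'_def)
  qed
  have c_L': "z \<in> L'" if "z \<in> Z" "c z \<noteq> 0" for z
    using that by (auto simp: c_def L'_def max_def split: if_splits)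
  have q_nonneg: "0 \<le> q z" for z
    unfolding q_def by (rule sum_nonneg) simp
  have c_bounds: "0 \<le> c z" "c z \<le> 1" for z
    using q_nonneg[of z] by (auto simp: c_def)
  have g_simplex: "g z v \<in> simplex_on {1..Suc m}" if z: "z \<in> L'" and v: "v \<in> W" for z v
  proof -
    have g: "g z v = (\<lambda>i. s z v i / t z v)" and t: "0 < t z v"
      using t_L'[OF z v] by (auto simp: g_def max_def)
    have "(\<Sum>i\<in>{1..Suc m}. g z v i) = 1"
      unfolding g sum_divide_distrib[symmetric] t_def[symmetric] using t by simp
    then show ?thesis
      using t s_nonneg s_zero by (auto simp: simplex_on_def g)
  qed
  have g_edge: "g z u i = 0 \<or> g z v i = 0" if "u \<in> W" "v \<in> W" "(u, v) \<in> E" for z u v i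
    using s_edge[OF that] by (auto simp: g_def)
  \<comment> \<open>Off \<open>I\<close>, \<open>g\<close> avoids colour \<open>Suc m\<close>, so
    over \<open>L'\<close> it maps to the colouring space of \<open>W - I\<close> with
    \<open>m\<close> colours.\<close>
  have "continuous_map (top_of_set L') (hom_space (W - I) (hom_points E (W - I) m)) (\<lambda>z. \<lambda>v\<in>W - I. g z v)"
    unfolding continuous_map_into_hom_space_iff[OF hom_points_extensional]
  proof (intro conjI ballI allI)
    show "(\<lambda>z. \<lambda>v\<in>W - I. g z v) ` L' \<subseteq> hom_points E (W - I) m"
    proof (rule image_subsetI)
      fix z assume z: "z \<in> L'"
      have "g z v \<in> simplex_on {1..m}" if v: "v \<in> W - I" for v
      proof (rule simplex_on_support[OF g_simplex[OF z]])
        show "{i. g z v i \<noteq> 0} \<subseteq> {1..m}"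
          using v by (auto simp: g_def s_def split: if_splits)
      qed (use v in auto)
      then show "(\<lambda>v\<in>W - I. g z v) \<in> hom_points E (W - I) m"
        using g_edge by (auto simp: hom_points_def)
    qed
    show "continuous_on L' (\<lambda>z. (\<lambda>v\<in>W - I. g z v) v i)" if "v \<in> W - I" for v i
      using that continuous_on_subset[OF g_cont L'(2)] by auto
  qed
  moreover have "K < card {i. i < K \<and> x i \<in> R} + d" if "x \<in> Z - L'" for x
    using dim that L' by blast
  ultimately obtain H where H: "continuous_map (top_of_set Z) (hom_space (W - I) (hom_points E (W - I) m)) H"
    and Hg: "\<And>z. z \<in> L' \<Longrightarrow> H z = (\<lambda>v\<in>W - I. g z v)"
    using abs_extensorD[OF AE Z \<open>closed L'\<close> L'(2) ZK R] by blast
  have H_cont: "\<And>v i. v \<in> W - I \<Longrightarrow> continuous_on Z (\<lambda>z. H z v i)"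
    and HS: "\<And>z. z \<in> Z \<Longrightarrow> H z \<in> hom_points E (W - I) m"
    using H unfolding continuous_map_into_hom_space_iff[OF hom_points_extensional] by auto
  have H_simplex: "\<And>z v. z \<in> Z \<Longrightarrow> v \<in> W - I \<Longrightarrow> H z v \<in> simplex_on {1..m}"
    and H_edge: "\<And>z u v i. z \<in> Z \<Longrightarrow> u \<in> W - I \<Longrightarrow> v \<in> W - I \<Longrightarrow> (u, v) \<in> E \<Longrightarrow> H z u i = 0 \<or> H z v i = 0"
    using HS by (auto simp: hom_points_def PiE_iff)
  have H_last: "H z v (Suc m) = 0" if "z \<in> Z" "v \<in> W - I" for z v
    using H_simplex[OF that] by (simp add: simplex_on_def)
  define \<delta> :: "nat \<Rightarrow> real" where "\<delta> i = (if i = Suc m then 1 else 0)" for i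
  \<comment> \<open>On \<open>I\<close>, \<open>g\<close> is blended into the pure last colour
    \<open>\<delta>\<close>: \<open>c = 1\<close> on \<open>L\<close> returns \<open>f\<close>, and
    off \<open>L'\<close> only \<open>\<delta>\<close> remains, which conflicts with no value of
    \<open>H\<close>.\<close>
  define F where "F z v = (if v \<in> I then (\<lambda>i. c z * g z v i + (1 - c z) * \<delta> i) else H z v)" for z v
  have \<delta>_simplex: "\<delta> \<in> simplex_on {1..Suc m}"
    by (auto simp: simplex_on_def \<delta>_def)
  have F_simplex: "F z v \<in> simplex_on {1..Suc m}" if z: "z \<in> Z" and v: "v \<in> W" for z v
  proof (cases "v \<in> I")
    case False
    then show ?thesis
      using H_simplex[OF z, of v] v simplex_on_mono[of "{1..m}" "{1..Suc m}"] by (auto simp: F_def)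
  next
    case True
    show ?thesis
    \<comment> \<open>The values of \<open>g\<close> are known to lie in the simplex only over
      \<open>L'\<close>, and \<open>c z \<noteq> 0\<close> places \<open>z\<close> there.\<close>
    proof (cases "c z = 0")
      case True
      then show ?thesis using \<open>v \<in> I\<close> \<delta>_simplex by (simp add: F_def)
    next
      case False
      then show ?thesis
        using simplex_on_convex[OF g_simplex[OF c_L'[OF z False] v] \<delta>_simplex c_bounds] \<open>v \<in> I\<close>
        by (simp add: F_def)
    qed
  qed
  have F_edge': "F z u i = 0 \<or> F z v i = 0"
    if z: "z \<in> Z" and u: "u \<in> I" and v: "v \<in> W - I" and uv: "(u, v) \<in> E" for z u v i
  \<comment> \<open>A conflict could arise only in a colour other than the last and with
    \<open>c z \<noteq> 0\<close>. Then \<open>z\<close> is in \<open>L'\<close>, where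
    \<open>H\<close> agrees with \<open>g\<close>, and \<open>g\<close> respects edges.\<close>
  proof (cases "i = Suc m \<or> c z = 0 \<or> g z u i = 0")
    case True
    then show ?thesis using H_last[OF z v] u v by (auto simp: F_def \<delta>_def)
  next
    case False
    then have "g z v i = 0" using g_edge[OF _ _ uv] u v \<open>I \<subseteq> W\<close> by blast
    moreover have "z \<in> L'" using c_L'[OF z] False by blast
    ultimately show ?thesis using Hg v by (simp add: F_def)
  qed
  have F_edge: "F z u i = 0 \<or> F z v i = 0"
    if z: "z \<in> Z" and uv: "u \<in> W" "v \<in> W" "(u, v) \<in> E" for z u v i
  proof -
    have vu: "(v, u) \<in> E" using uv(3) \<open>sym E\<close> by (rule symD[rotated])
    consider "u \<in> I" "v \<in> I" | "u \<in> I" "v \<in> W - I" | "u \<in> W - I" "v \<in> I" | "u \<in> W - I" "v \<in> W - I"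
      using uv by blast
    then show ?thesis
    proof cases
      case 1 then show ?thesis using I uv by blast
    next
      case 2 then show ?thesis using F_edge'[OF z _ _ uv(3)] by blast
    next
      case 3 then show ?thesis using F_edge'[OF z _ _ vu] by blast
    next
      case 4 then show ?thesis using H_edge[OF z _ _ uv(3)] by (simp add: F_def)
    qed
  qed
  have "continuous_map (top_of_set Z) (hom_space W (hom_points_on E W (Suc m) I)) F"
    unfolding continuous_map_into_hom_space_iff[OF ext]
  proof (intro conjI ballI allI)
    show "F ` Z \<subseteq> hom_points_on E W (Suc m) I"
    proof (rule image_subsetI)
      fix z assume z: "z \<in> Z"
      have "H z \<in> extensional (W - I)" using HS[OF z] hom_points_extensional by blast
      then have "F z v = undefined" if "v \<notin> W" for v
        using that \<open>I \<subseteq> W\<close> by (auto simp: F_def extensional_def)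
      then have "F z \<in> W \<rightarrow>\<^sub>E simplex_on {1..Suc m}"
        using F_simplex[OF z] by (intro PiE_I) auto
      moreover have "F z v (Suc m) = 0" if "v \<in> W - I" for v
        using H_last[OF z that] that by (simp add: F_def)
      ultimately show "F z \<in> hom_points_on E W (Suc m) I"
        unfolding hom_points_on_def hom_points_def using F_edge[OF z] by blast
    qed
    show "continuous_on Z (\<lambda>z. F z v i)" if "v \<in> W" for v i
    proof (cases "v \<in> I")
      case True
      then have "(\<lambda>z. F z v i) = (\<lambda>z. c z * g z v i + (1 - c z) * \<delta> i)" by (simp add: F_def)
      then show ?thesis by (simp only:) (intro continuous_intros c_cont g_cont that)
    next
      case False
      then show ?thesis using H_cont[of v i] that by (simp add: F_def)
    qed
  qed
  moreover have "F z = f z" if z: "z \<in> L" for z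
  proof
    fix v
    have "z \<in> L'" using z L' by blast
    show "F z v = f z v"
    proof (cases "v \<in> W")
      case True
      then show ?thesis
        using g_f[OF z True] Hg[OF \<open>z \<in> L'\<close>] q_f[OF z] by (auto simp: F_def c_def)
    next
      case False
      then have "v \<notin> I" "v \<notin> W - I" using \<open>I \<subseteq> W\<close> by auto
      then show ?thesis
        using Hg[OF \<open>z \<in> L'\<close>] f_ext[OF z] False by (simp add: F_def extensional_def)
    qed
  qed
  ultimately show "\<exists>F. continuous_map (top_of_set Z) (hom_space W (hom_points_on E W (Suc m) I)) F \<and>
      (\<forall>x\<in>L. F x = f x)"
    by blast
qed

section \<open>Induction on the number of colours\<close>

text \<open>Without vertices there is a single point, even for \<open>n = 0\<close>. The case stands
  apart because deleting a maximal independent set does not lower \<open>chi_dot\<close> of the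
  empty graph.\<close>

lemma abs_extensor_hom_space_empty: "abs_extensor d (hom_space {} (hom_points E {} n))"
  unfolding abs_extensor_def
proof (intro allI impI, elim conjE)
  fix Z L :: "(nat \<Rightarrow> real) set" and f :: "(nat \<Rightarrow> real) \<Rightarrow> 'a \<Rightarrow> nat \<Rightarrow> real"
  assume "continuous_map (top_of_set L) (hom_space {} (hom_points E {} n)) f"
  then have "f ` L \<subseteq> hom_points E {} n"
    unfolding continuous_map_into_hom_space_iff[OF hom_points_extensional] by blast
  then have "f x = (\<lambda>_. undefined)" if "x \<in> L" for x
    using that by (auto simp: hom_points_def)
  moreover have "continuous_map (top_of_set Z) (hom_space {} (hom_points E {} n)) (\<lambda>_ _. undefined)"
    unfolding continuous_map_into_hom_space_iff[OF hom_points_extensional]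
    by (auto simp: hom_points_def)
  ultimately show "\<exists>F. continuous_map (top_of_set Z) (hom_space {} (hom_points E {} n)) F \<and>
      (\<forall>x\<in>L. F x = f x)"
    by (intro exI[of _ "\<lambda>_ _. undefined"]) simp
qed

lemma hom_points_on_Int: "hom_points_on E W n I \<inter> hom_points_on E W n J = hom_points_on E W n (I \<inter> J)"
  by (auto simp: hom_points_on_def)

text \<open>The vertices that use colour \<open>n\<close> at a given point are pairwise
  non-adjacent, so some maximal independent set contains them.\<close>

lemma hom_points_eq_UNION:
  assumes "finite W"
  shows "hom_points (arcs_ends G) W n =
    (\<Union>I\<in>{I. maximal_independent (G \<restriction> W) I}. hom_points_on (arcs_ends G) W n I)"
proof (intro subset_antisym subsetI)
  fix x assume x: "x \<in> hom_points (arcs_ends G) W n"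
  have "independent_set (G \<restriction> W) {v \<in> W. x v n \<noteq> 0}"
    using x by (auto simp: independent_set_induce_iff hom_points_def)
  then obtain I where "{v \<in> W. x v n \<noteq> 0} \<subseteq> I" "maximal_independent (G \<restriction> W) I"
    by (rule independent_set_extend_maximal[OF assms])
  then show "x \<in> (\<Union>I\<in>{I. maximal_independent (G \<restriction> W) I}. hom_points_on (arcs_ends G) W n I)"
    using x by (auto simp: hom_points_on_def)
qed (auto simp: hom_points_on_def)

lemma subtopology_hom_space:
  "S \<subseteq> T \<Longrightarrow> subtopology (hom_space W T) S = hom_space W S"
  by (simp add: hom_space_def subtopology_subtopology Int_absorb1)

text \<open>The induction treats all \<open>W\<close> at once, since each piece is controlled by
  \<open>W - I\<close> with one colour fewer. Truncated subtraction is harmless, degree 0 being no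
  condition.\<close>

lemma abs_extensor_hom_space:
  assumes "graph G" "W \<subseteq> verts G"
  shows "abs_extensor (n + 1 - chi_dot (G \<restriction> W)) (hom_space W (hom_points (arcs_ends G) W n))"
  using assms(2)
proof (induction n arbitrary: W)
  case 0
  interpret graph G by fact
  have W: "finite W" using 0 finite_verts finite_subset by blast
  show ?case
  proof (cases "W = {}")
    case True
    then show ?thesis using abs_extensor_hom_space_empty by simp
  next
    case False
    have "independent_set (G \<restriction> W) {}" by (simp add: independent_set_def)
    then obtain I where "maximal_independent (G \<restriction> W) I"
      by (rule independent_set_extend_maximal[OF W])
    \<comment> \<open>On a nonempty vertex set \<open>chi_dot\<close> is at least 1, so without
      colours the claim has degree 0.\<close>
    then have "0 < chi_dot (G \<restriction> W)"
      using chi_dot_remove_maximal_independent[OF W False] by fastforce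
    then have "0 + 1 - chi_dot (G \<restriction> W) = 0" by simp
    then show ?thesis by (simp only: abs_extensor_0)
  qed
next
  case (Suc m)
  interpret graph G by fact
  have W: "finite W" using Suc.prems finite_verts finite_subset by blast
  let ?E = "arcs_ends G"
  let ?X = "hom_space W (hom_points ?E W (Suc m))"
  let ?S = "hom_points_on ?E W (Suc m)"
  define d where "d = Suc m + 1 - chi_dot (G \<restriction> W)"
  have sub: "subtopology ?X (?S I) = hom_space W (?S I)" for I
    by (rule subtopology_hom_space) (auto simp: hom_points_on_def)
  have AE: "abs_extensor (m + 1 - chi_dot (G \<restriction> (W - I))) (subtopology ?X (?S I))"
    if "independent_set (G \<restriction> W) I" for I
    unfolding sub
  proof (rule abs_extensor_hom_points_on[OF W])
    show "I \<subseteq> W" "\<And>u v. u \<in> I \<Longrightarrow> v \<in> I \<Longrightarrow> (u, v) \<notin> ?E"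
      using that by (auto simp: independent_set_induce_iff)
    show "sym ?E" using sym_arcs by (simp add: symmetric_def)
    show "abs_extensor (m + 1 - chi_dot (G \<restriction> (W - I))) (hom_space (W - I) (hom_points ?E (W - I) m))"
      by (rule Suc.IH) (use Suc.prems in auto)
  qed
  show ?case
  proof (cases "W = {}")
    case True
    then show ?thesis using abs_extensor_hom_space_empty by simp
  next
    case False
    have "abs_extensor d (subtopology ?X (\<Union>I\<in>{I. maximal_independent (G \<restriction> W) I}. ?S I))"
    proof (rule abs_extensor_UNION[where \<I> = "{I. independent_set (G \<restriction> W) I}"])
      show "finite {I. maximal_independent (G \<restriction> W) I}"
        by (rule finite_subset[of _ "Pow W"]) (use W maximal_independent_subset in auto)
      have "independent_set (G \<restriction> W) {}" by (simp add: independent_set_def)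
      then obtain I where "maximal_independent (G \<restriction> W) I"
        by (rule independent_set_extend_maximal[OF W])
      then show "{I. maximal_independent (G \<restriction> W) I} \<noteq> {}" by blast
      show "closedin ?X (?S I)" for I
        by (rule closedin_hom_points_on[OF W])
      show "abs_extensor d (subtopology ?X (?S I))" if "I \<in> {I. maximal_independent (G \<restriction> W) I}" for I
      proof (rule abs_extensor_mono[OF AE])
        show "independent_set (G \<restriction> W) I" using that by (simp add: maximal_independent_def)
        show "d \<le> m + 1 - chi_dot (G \<restriction> (W - I))"
          using chi_dot_remove_maximal_independent[OF W False, of I] that by (auto simp: d_def)
      qed
      show "abs_extensor (d - 1) (subtopology ?X (?S I))" if "I \<in> {I. independent_set (G \<restriction> W) I}" for I
      proof (rule abs_extensor_mono[OF AE])
        show "d - 1 \<le> m + 1 - chi_dot (G \<restriction> (W - I))"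
          using chi_dot_induce_mono[OF W, of "W - I"] by (auto simp: d_def)
      qed (use that in simp)
    qed (auto simp: maximal_independent_def independent_set_induce_iff hom_points_on_Int)
    then show ?thesis
      unfolding hom_points_eq_UNION[OF W, symmetric] d_def
      by (simp add: subtopology_hom_space)
  qed
qed

section \<open>Connectedness\<close>

lemma nsphere_eq_top_of_set:
  "nsphere i = top_of_set (flat_space (Suc i) \<inter> {x. (\<Sum>k\<le>i. (x k)\<^sup>2) = 1})"
  by (simp add: nsphere Euclidean_space_def subtopology_subtopology euclidean_product_topology
      flat_space_def Suc_le_eq Int_def conj_commute)

lemma closed_flat_space: "closed (flat_space K)"
proof -
  have "flat_space K = (\<Inter>i\<in>{K..}. {x. x i = 0})"
    by (auto simp: flat_space_def)
  then show ?thesis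
    by (auto intro!: closed_INT closed_Collect_eq continuous_on_product_coordinates)
qed

text \<open>Extend \<open>f\<close> to the ball and move each point of the sphere along the chord to
  the base point. Chords stay in the ball, and the base point does not move, so the homotopy is
  based.\<close>

lemma nullhomotopic_nsphere_if_abs_extensor:
  assumes AE: "abs_extensor (i + 2) X"
    and f: "continuous_map (nsphere i) X f" "f nsphere_base = b"
  shows "homotopic_with (\<lambda>h. h nsphere_base = b) (nsphere i) X f (\<lambda>_. b)"
proof -
  define N where "N x = (\<Sum>k\<le>i. (x k)\<^sup>2)" for x :: "nat \<Rightarrow> real"
  define S where "S = flat_space (Suc i) \<inter> {x. N x = 1}"
  define D where "D = flat_space (Suc i) \<inter> {x. N x \<le> 1}"
  have nsphere: "nsphere i = top_of_set S"
    by (simp add: nsphere_eq_top_of_set S_def N_def)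
  have N_cont: "continuous_on UNIV N"
    unfolding N_def by (intro continuous_intros continuous_on_product_coordinates)
  have "closed S" "closed D"
    unfolding S_def D_def using closed_flat_space N_cont
    by (auto intro!: closed_Int closed_Collect_eq closed_Collect_le)
  have base: "nsphere_base \<in> S"
  proof -
    have "N nsphere_base = (\<Sum>k\<le>i. if k = 0 then 1 else 0)"
      unfolding N_def nsphere_base_def by (intro sum.cong) auto
    then show ?thesis by (simp add: S_def flat_space_def nsphere_base_def)
  qed
  have SD: "S \<subseteq> D" by (auto simp: S_def D_def)
  have DK: "D \<subseteq> flat_space (Suc i)" by (auto simp: D_def)
  \<comment> \<open>The ball lies in a flat of dimension \<open>i + 1\<close>, below
    \<open>i + 2\<close>, so the empty set can serve as \<open>R\<close>.\<close>
  have dim: "Suc i < card {k. k < Suc i \<and> x k \<in> ({} :: real set)} + (i + 2)" for x :: "nat \<Rightarrow> real"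
    by simp
  obtain F where F: "continuous_map (top_of_set D) X F" "\<And>x. x \<in> S \<Longrightarrow> F x = f x"
    using abs_extensorD[OF AE \<open>closed D\<close> \<open>closed S\<close> SD DK countable_empty dim f(1)[unfolded nsphere]]
    by blast
  define c where "c p = (\<lambda>k. (1 - fst p) * snd p k + fst p * nsphere_base k)"
    for p :: "real \<times> (nat \<Rightarrow> real)"
  have "continuous_on ({0..1} \<times> S) c"
  proof (rule continuous_on_coordinatewise_then_product)
    fix k
    have "continuous_on ({0..1} \<times> S) (\<lambda>p. snd p k)"
      by (rule continuous_on_product_then_coordinatewise[OF continuous_on_snd[OF continuous_on_id]])
    then show "continuous_on ({0..1} \<times> S) (\<lambda>p. c p k)"
      unfolding c_def
      by (intro continuous_on_add continuous_on_mult continuous_on_diff continuous_on_const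
          continuous_on_fst continuous_on_id)
  qed
  moreover have "c p \<in> D" if p01: "p \<in> {0..1} \<times> S" for p
  proof -
    obtain t x where p: "p = (t, x)" "0 \<le> t" "t \<le> 1" "x \<in> S" using p01 by auto
    have sq: "((1 - t) * a + t * b)\<^sup>2 \<le> (1 - t) * a\<^sup>2 + t * b\<^sup>2" for a b :: real
    proof -
      have "(1 - t) * a\<^sup>2 + t * b\<^sup>2 - ((1 - t) * a + t * b)\<^sup>2 = t * (1 - t) * (a - b)\<^sup>2"
        by (simp add: power2_eq_square algebra_simps)
      moreover have "0 \<le> t * (1 - t) * (a - b)\<^sup>2" using p by simp
      ultimately show ?thesis by linarith
    qed
    have "N (c p) \<le> (\<Sum>k\<le>i. (1 - t) * (x k)\<^sup>2 + t * (nsphere_base k)\<^sup>2)"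
      unfolding N_def c_def p(1) fst_conv snd_conv by (intro sum_mono sq)
    also have "\<dots> = (1 - t) * N x + t * N nsphere_base"
      by (simp add: N_def sum.distrib sum_distrib_left)
    also have "\<dots> = 1" using p base by (simp add: S_def)
    finally have "N (c p) \<le> 1" .
    then show ?thesis using p base by (auto simp: D_def S_def c_def flat_space_def)
  qed
  ultimately have "continuous_map (top_of_set ({0..1} \<times> S)) (top_of_set D) c"
    by auto
  then have cont: "continuous_map (prod_topology (top_of_set {0..1}) (nsphere i)) X (F \<circ> c)"
    unfolding nsphere using F(1)
    by (simp add: prod_topology_subtopology_eu continuous_map_compose del: continuous_map_subtopology_eu)
  have c0: "c (0, x) = x" and c1: "c (1, x) = nsphere_base"
    and cb: "c (t, nsphere_base) = nsphere_base" for t x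
    by (auto simp: c_def algebra_simps)
  have Fb: "F nsphere_base = b" using F(2)[OF base] f(2) by simp
  have top: "topspace (nsphere i) = S" by (simp add: nsphere)
  show ?thesis
  proof (subst homotopic_with)
    show "(h nsphere_base = b) = (k nsphere_base = b)"
      if "\<And>x. x \<in> topspace (nsphere i) \<Longrightarrow> h x = k x" for h k
      using that[of nsphere_base] base top by simp
    show "\<exists>h. continuous_map (prod_topology (top_of_set {0..1::real}) (nsphere i)) X h \<and>
        (\<forall>x\<in>topspace (nsphere i). h (0, x) = f x) \<and>
        (\<forall>x\<in>topspace (nsphere i). h (1, x) = b) \<and>
        (\<forall>t\<in>{0..1}. h (t, nsphere_base) = b)"
      by (rule exI[of _ "F \<circ> c"]) (use cont F(2) Fb in \<open>simp add: top c0 c1 cb\<close>)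
  qed
qed

lemma m_connected_if_abs_extensor:
  assumes AE: "abs_extensor d X" and d: "m + 2 \<le> int d"
  shows "m_connected m X"
  unfolding m_connected_def
proof (intro conjI impI allI ballI)
  assume "-1 \<le> m"
  then have "0 < d" using d by simp
  \<comment> \<open>Extending the empty map to a one-point space, of dimension \<open>0 < d\<close>,
    yields a point of \<open>X\<close>.\<close>
  have "\<exists>F. continuous_map (top_of_set {(\<lambda>_. 0) :: nat \<Rightarrow> real}) X F"
    using AE[unfolded abs_extensor_def, rule_format, of "{\<lambda>_. 0}" "{}" 0 "{}" undefined] \<open>0 < d\<close>
    by (auto simp: flat_space_def)
  then show "topspace X \<noteq> {}"
    by (auto simp: continuous_map_def)
next
  fix i b assume i: "int i \<le> m" and b: "b \<in> topspace X"
  define A where "A = {f. continuous_map (nsphere i) X f \<and> f nsphere_base = b}"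
  define r where "r = {(f, g). homotopic_with (\<lambda>h. h nsphere_base = b) (nsphere i) X f g}"
  have AEi: "abs_extensor (i + 2) X"
    by (rule abs_extensor_mono[OF AE]) (use i d in linarith)
  have null: "homotopic_with (\<lambda>h. h nsphere_base = b) (nsphere i) X f (\<lambda>_. b)" if "f \<in> A" for f
    using nullhomotopic_nsphere_if_abs_extensor[OF AEi] that by (auto simp: A_def)
  \<comment> \<open>All maps in \<open>A\<close> are based homotopic to the constant map, so each
    class is all of \<open>A\<close>.\<close>
  have "r `` {f} = A" if f: "f \<in> A" for f
  proof (intro subset_antisym subsetI)
    fix g assume "g \<in> r `` {f}"
    then have fg: "homotopic_with (\<lambda>h. h nsphere_base = b) (nsphere i) X f g" by (simp add: r_def)
    show "g \<in> A"
      using homotopic_with_imp_continuous_maps[OF fg] homotopic_with_imp_property[OF fg]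
      by (simp add: A_def)
  next
    fix g assume "g \<in> A"
    then show "g \<in> r `` {f}"
      using homotopic_with_trans[OF null[OF f] homotopic_with_symD[OF null]] by (simp add: r_def)
  qed
  moreover have "(\<lambda>_. b) \<in> A" using b by (simp add: A_def)
  ultimately have "A // r = {A}"
    by (auto simp: quotient_def)
  then show "is_singleton (homotopy_set i X b)"
    by (simp add: homotopy_set_def A_def r_def is_singleton_def)
qed

theorem theorem2p2:
  fixes G :: "('a, 'b) pre_digraph" and n :: nat
  assumes "graph G" and "n \<ge> 1"
  shows "m_connected (int n - int (chi_dot G) - 1) (Hom_complex G n)"
proof (rule m_connected_if_abs_extensor)
  interpret graph G by fact
  \<comment> \<open>For \<open>m = n - chi_dot G - 1\<close> the required degree is the integer
    \<open>m + 2 = n + 1 - chi_dot G\<close>, which truncation at 0 can only raise.\<close>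
  show "abs_extensor (n + 1 - chi_dot G) (Hom_complex G n)"
    using abs_extensor_hom_space[OF \<open>graph G\<close> subset_refl, of n]
    by (simp add: Hom_complex_eq_hom_space induce_subgraph_verts_eq wf_digraph)
qed simp

end
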